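(* Let $\mathcal C$ be an $(n,k)$ Reed-Solomon code over $\mathrm{GF}(q)$ with minimum distance $d=n-k+1$, put $t_0=d/2$, and let $t$ be an integer with $t_0<t<n-\sqrt{n(n-d)}$. Choose $$m=\left\lfloor \frac{t(2t_0-t)}{t^2-2n(t-t_0)}\right\rfloor ,\qquad P_y=\left\lfloor\frac{tm}{2t-2t_0}\right\rfloor .$$ Then, for every received word $R\in \mathrm{GF}(q)^n$, the list decoding algorithm for Reed-Solomon codes described in the context, run with parameters $t,m,P_y$, produces all codewords of $\mathcal C$ within Hamming distance $t$ from $R$.
   Context: **Code.** $\alpha$ is a primitive element of $\mathrm{GF}(q)$, $m_0$ is an integer, $1\le k<n\le q-1$, $d=n-k+1$. The code $\mathcal C$ is the set of polynomials $C(x)=\sum_{i=0}^{n-1}C_ix^i$ over $\mathrm{GF}(q)$ divisible by $\prod_{i=0}^{n-k-1}(x-\alpha^{m_0+i})$. A received word is $R(x)=\sum_{i=0}^{n-1}R_ix^i$, with syndromes $S_i=R(\alpha^{i+m_0})$, $0\le i\le n-k-1$. **Berlekamp-Massey algorithm.** Start with $\Lambda^{(0)}=B^{(0)}=1$, $L^{(0)}_\Lambda=L^{(0)}_B=0$. For $r=0,\dots,n-k-1$: $\Delta^{(r+1)}=\sum_{i=0}^{L_\Lambda^{(r)}}\Lambda^{(r)}_iS_{r-i}$; $\Lambda^{(r+1)}=\Lambda^{(r)}-\Delta^{(r+1)}xB^{(r)}$; if $\Delta^{(r+1)}\ne0$ and $2L^{(r)}_\Lambda\le r$ then $B^{(r+1)}=(\Delta^{(r+1)})^{-1}\Lambda^{(r)}$,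 $L_\Lambda^{(r+1)}=L_B^{(r)}+1$, $L_B^{(r+1)}=L_\Lambda^{(r)}$; otherwise $B^{(r+1)}=xB^{(r)}$, $L_B^{(r+1)}=L_B^{(r)}+1$, $L_\Lambda^{(r+1)}=L_\Lambda^{(r)}$. The output is the final $\Lambda(x),B(x),L_\Lambda,L_B$; put $L_{xB}=L_B+1$ and $w=L_\Lambda-L_{xB}$. **Interpolation notions.** A polynomial $Q(x,y)$ of $y$-degree at most $P_y$ passes through $(a,c)$, $c\in \mathrm{GF}(q)$, with multiplicity $m$ if $Q(x+a,y+c)$ has no monomial $x^uy^v$ with $u+v<m$; it passes through $(a,\infty)$ with multiplicity $m$ if $\bar Q(x,y)=y^{P_y}Q(x,1/y)$ passes through $(a,0)$ with multiplicity $m$. The $(1,w)$-weighted degree of $Q$ is the maximum of $u+wv$ over its monomials $x^uy^v$ ($w$ may be negative). **List decoding algorithm** (parameters $t,m,P_y$): 1. Compute the syndromes of $R$. 2. Run the Berlekamp-Massey algorithm. If $L_\Lambda>t$, declare failure (empty list). 3. For $0\le i\le n-1$ put $y_i=-\Lambda(\alpha^{-i})/(\alpha^{-i}B(\alpha^{-i}))$, with $y_i=\infty$ if $B(\alpha^{-i})=0$. 4. If $L_{xB}>t$: if $\Lambda(x)$ has exactly $L_\Lambda$ distinct roots in $\{\alpha^{-i}\}_{i=0}^{n-1}$, return the corresponding unique codeword (error positions are the $i$ with $\Lambda(\alpha^{-i})=0$, error values by Forney's formula); otherwise declare failure. Stop. 5. Compute a nonzero $Q(x,y)$ of $y$-degree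 at most $P_y$ and of minimum $(1,w)$-weighted degree passing through all points $(\alpha^{-i},y_i)$, $0\le i\le n-1$, each with multiplicity $m$. 6. Rational factorization: starting from $Q^{(0)}=Q$, recursively, for each root $s\in \mathrm{GF}(q)$ of $Q^{(i)}(0,y)$, take $s$ as the coefficient $s_i$ and set $Q^{(i+1)}(x,y)=Q^{(i)}(x,s+xy)/x^a$, with $x^a$ the largest power of $x$ dividing $Q^{(i)}(x,s+xy)$. Collect all resulting series $s(x)=\sum_{i<L_s}s_ix^i$, where $L_s=3t+1-2t_0-L_\Lambda$. 7. For each $s(x)$: apply the Berlekamp-Massey algorithm to the $2(t-L_\Lambda)$ terms of $s(x)$ starting with $s_{t-L_{xB}+1}$ to obtain $\lambda(x)$; compute $b(x)=s(x)\lambda(x) \bmod x^{t-L_{xB}+1}$; form $\Lambda'(x)=\lambda(x)\Lambda(x)+b(x)\,xB(x)$; determine its distinct roots in $\{\alpha^{-i}\}_{i=0}^{n-1}$; if their number equals the degree of $\Lambda'$, take the $i$ with $\Lambda'(\alpha^{-i})=0$ as error positions, compute error values by Forney's formula, and subtract the errors from $R$. 8. Return the list of those resulting words that are codewords within distance $t$ from $R$. *)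

theory Defs
  imports Complex_Main "HOL-Library.Cardinality" "HOL-Computational_Algebra.Computational_Algebra"
begin

text \<open>
  GF(q) is a type of sort \<open>{field,finite}\<close> with \<open>q = CARD('a)\<close>. A word of length \<open>n\<close> is a
  polynomial of degree less than \<open>n\<close>. Bivariate polynomials have type \<open>'a poly poly\<close>, the outer
  variable being \<open>y\<close>: the coefficient of \<open>x^u y^v\<close> in \<open>Q\<close> is \<open>coeff (coeff Q v) u\<close>.
\<close>

definition primitive_element :: "'a::{field,finite} \<Rightarrow> bool" where
  "primitive_element \<alpha> \<longleftrightarrow> range (\<lambda>i::nat. \<alpha> ^ i) = UNIV - {0}"

definition words :: "nat \<Rightarrow> 'a::{field,finite} poly set" where
  "words n = {R. degree R < n}"

definition RS_code :: "'a::{field,finite} \<Rightarrow> int \<Rightarrow> nat \<Rightarrow> nat \<Rightarrow> 'a poly set" where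
  "RS_code \<alpha> m0 n k = {C \<in> words n. (\<Prod>i<n - k. [:- (\<alpha> powi (m0 + int i)), 1:]) dvd C}"

definition hamming_dist :: "'a::{field,finite} poly \<Rightarrow> 'a poly \<Rightarrow> nat" where
  "hamming_dist P Q = card {i. coeff P i \<noteq> coeff Q i}"

definition syndrome :: "'a::{field,finite} \<Rightarrow> int \<Rightarrow> 'a poly \<Rightarrow> nat \<Rightarrow> 'a" where
  "syndrome \<alpha> m0 R i = poly R (\<alpha> powi (int i + m0))"


subsection \<open>The Berlekamp-Massey algorithm\<close>

record (overloaded) 'a bm_state =
  bm_Lambda :: "'a poly"
  bm_B :: "'a poly"
  bm_L_Lambda :: nat
  bm_L_B :: nat

text \<open>
  In the discrepancy the index \<open>r - i\<close> is never truncated, as \<open>bm_L_Lambda + bm_L_B = r\<close> holds in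
  the \<open>r\<close>-th state. The factor \<open>[:0, 1:]\<close> is the polynomial \<open>x\<close>.
\<close>

definition bm_step :: "(nat \<Rightarrow> 'a::{field,finite}) \<Rightarrow> nat \<Rightarrow> 'a bm_state \<Rightarrow> 'a bm_state" where
  "bm_step S r st =
     (let \<Lambda> = bm_Lambda st; B = bm_B st; L\<^sub>\<Lambda> = bm_L_Lambda st; L\<^sub>B = bm_L_B st;
          \<Delta> = (\<Sum>i\<le>L\<^sub>\<Lambda>. coeff \<Lambda> i * S (r - i));
          \<Lambda>' = \<Lambda> - smult \<Delta> ([:0, 1:] * B)
      in if \<Delta> \<noteq> 0 \<and> 2 * L\<^sub>\<Lambda> \<le> r
         then \<lparr>bm_Lambda = \<Lambda>', bm_B = smult (inverse \<Delta>) \<Lambda>,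
               bm_L_Lambda = L\<^sub>B + 1, bm_L_B = L\<^sub>\<Lambda>\<rparr>
         else \<lparr>bm_Lambda = \<Lambda>', bm_B = [:0, 1:] * B,
               bm_L_Lambda = L\<^sub>\<Lambda>, bm_L_B = L\<^sub>B + 1\<rparr>)"

text \<open>\<open>berlekamp_massey S N\<close> processes the terms \<open>S 0, \<dots>, S (N - 1)\<close>.\<close>

primrec berlekamp_massey :: "(nat \<Rightarrow> 'a::{field,finite}) \<Rightarrow> nat \<Rightarrow> 'a bm_state" where
  "berlekamp_massey S 0 = \<lparr>bm_Lambda = 1, bm_B = 1, bm_L_Lambda = 0, bm_L_B = 0\<rparr>"
| "berlekamp_massey S (Suc r) = bm_step S r (berlekamp_massey S r)"


subsection \<open>Roots of locator polynomials and Forney's formula\<close>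

definition locator_roots :: "'a::{field,finite} \<Rightarrow> nat \<Rightarrow> 'a poly \<Rightarrow> 'a set" where
  "locator_roots \<alpha> n P = {x \<in> (\<lambda>i. \<alpha> powi (- int i)) ` {..<n}. poly P x = 0}"

definition error_positions :: "'a::{field,finite} \<Rightarrow> nat \<Rightarrow> 'a poly \<Rightarrow> nat set" where
  "error_positions \<alpha> n P = {i. i < n \<and> poly P (\<alpha> powi (- int i)) = 0}"

text \<open>
  Forney's formula for the locator \<open>P\<close>: with \<open>S(x) = \<Sum>i<n-k. S\<^sub>i x^i\<close> and the error evaluator
  \<open>\<Omega> = S P mod x^(n-k)\<close>, the error at position \<open>i\<close> has the value
  \<open>- X^(1 - m0) \<Omega>(1/X) / P'(1/X)\<close>, where \<open>X = \<alpha>^i\<close> and \<open>P'\<close> is the formal derivative. The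
  exponent \<open>1 - m0\<close> reflects that the syndromes are taken at \<open>\<alpha>^m0, \<alpha>^(m0+1), \<dots>\<close>.
\<close>

definition syndrome_poly :: "'a::{field,finite} \<Rightarrow> int \<Rightarrow> nat \<Rightarrow> nat \<Rightarrow> 'a poly \<Rightarrow> 'a poly" where
  "syndrome_poly \<alpha> m0 n k R = (\<Sum>i<n - k. monom (syndrome \<alpha> m0 R i) i)"

definition forney_error ::
  "'a::{field,finite} \<Rightarrow> int \<Rightarrow> nat \<Rightarrow> nat \<Rightarrow> 'a poly \<Rightarrow> 'a poly \<Rightarrow> 'a poly" where
  "forney_error \<alpha> m0 n k R P =
     (let \<Omega> = (syndrome_poly \<alpha> m0 n k R * P) mod monom 1 (n - k)
      in \<Sum>i\<in>error_positions \<alpha> n P.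
           monom (- ((\<alpha> ^ i) powi (1 - m0)) * poly \<Omega> (\<alpha> powi (- int i))
                    / poly (pderiv P) (\<alpha> powi (- int i))) i)"


subsection \<open>Interpolation\<close>

definition shift2 :: "'a::{field,finite} \<Rightarrow> 'a \<Rightarrow> 'a poly poly \<Rightarrow> 'a poly poly" where
  "shift2 a c Q = map_poly (\<lambda>p. p \<circ>\<^sub>p [:a, 1:]) (Q \<circ>\<^sub>p [:[:c:], 1:])"

definition passes_through_finite ::
  "nat \<Rightarrow> 'a::{field,finite} poly poly \<Rightarrow> 'a \<Rightarrow> 'a \<Rightarrow> bool" where
  "passes_through_finite m Q a c \<longleftrightarrow>
     (\<forall>u v. u + v < m \<longrightarrow> coeff (coeff (shift2 a c Q) v) u = 0)"

text \<open>
  The polynomial \<open>y^Py Q(x, 1/y)\<close> for \<open>Q\<close> of \<open>y\<close>-degree at most \<open>Py\<close>. It differs from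
  \<^const>\<open>reflect_poly\<close> if the \<open>y\<close>-degree of \<open>Q\<close> is smaller than \<open>Py\<close>.
\<close>

definition y_reversal :: "nat \<Rightarrow> 'a::{field,finite} poly poly \<Rightarrow> 'a poly poly" where
  "y_reversal Py Q = (\<Sum>v\<le>Py. monom (coeff Q (Py - v)) v)"

text \<open>The second coordinate of a point is an option, \<^const>\<open>None\<close> standing for infinity.\<close>

definition passes_through ::
  "nat \<Rightarrow> nat \<Rightarrow> 'a::{field,finite} poly poly \<Rightarrow> 'a \<times> 'a option \<Rightarrow> bool" where
  "passes_through Py m Q pt =
     (case pt of
        (a, Some c) \<Rightarrow> passes_through_finite m Q a c
      | (a, None) \<Rightarrow> passes_through_finite m (y_reversal Py Q) a 0)"

text \<open>Only meaningful for nonzero \<open>Q\<close>.\<close>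

definition weighted_degree :: "int \<Rightarrow> 'a::{field,finite} poly poly \<Rightarrow> int" where
  "weighted_degree w Q = Max {int u + w * int v | u v. coeff (coeff Q v) u \<noteq> 0}"

definition interpolation_point ::
  "'a::{field,finite} \<Rightarrow> 'a poly \<Rightarrow> 'a poly \<Rightarrow> nat \<Rightarrow> 'a \<times> 'a option" where
  "interpolation_point \<alpha> \<Lambda> B i =
     (let a = \<alpha> powi (- int i)
      in (a, if poly B a = 0 then None else Some (- poly \<Lambda> a / (a * poly B a))))"

definition is_interpolant ::
  "nat \<Rightarrow> nat \<Rightarrow> int \<Rightarrow> ('a::{field,finite} \<times> 'a option) set \<Rightarrow> 'a poly poly \<Rightarrow> bool" where
  "is_interpolant m Py w pts Q \<longleftrightarrow>
     is_arg_min (weighted_degree w)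
       (\<lambda>Q. Q \<noteq> 0 \<and> degree Q \<le> Py \<and> (\<forall>pt\<in>pts. passes_through Py m Q pt)) Q"


subsection \<open>Rational factorization\<close>

text \<open>\<open>Q(x, s + x y)\<close> divided by the largest power of \<open>x\<close> dividing it.\<close>

definition rf_step :: "'a::{field,finite} \<Rightarrow> 'a poly poly \<Rightarrow> 'a poly poly" where
  "rf_step s Q =
     (let P = Q \<circ>\<^sub>p [:[:s:], [:0, 1:]:]
      in P div [:monom 1 (GREATEST a. [:monom 1 a:] dvd P):])"

text \<open>
  The polynomials \<open>\<Sum>i<L. s\<^sub>i x^i\<close> found within \<open>L\<close> levels of recursion. The map
  \<open>\<lambda>p. poly p 0\<close> turns \<open>Q(x, y)\<close> into \<open>Q(0, y)\<close>.
\<close>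

primrec rational_factorization :: "nat \<Rightarrow> 'a::{field,finite} poly poly \<Rightarrow> 'a poly set" where
  "rational_factorization 0 Q = {0}"
| "rational_factorization (Suc L) Q =
     {pCons s p | s p. poly (map_poly (\<lambda>p. poly p 0) Q) s = 0 \<and>
                       p \<in> rational_factorization L (rf_step s Q)}"


subsection \<open>The list decoding algorithm\<close>

text \<open>The polynomial \<open>\<Lambda>' = \<lambda> \<Lambda> + b x B\<close> obtained from a series \<open>s\<close>.\<close>

definition candidate_locator ::
  "nat \<Rightarrow> 'a::{field,finite} bm_state \<Rightarrow> 'a poly \<Rightarrow> 'a poly" where
  "candidate_locator t st s =
     (let N = t - (bm_L_B st + 1) + 1;
          lam = bm_Lambda (berlekamp_massey (\<lambda>j. coeff s (N + j)) (2 * (t - bm_L_Lambda st)));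
          b = (s * lam) mod monom 1 N
      in lam * bm_Lambda st + b * ([:0, 1:] * bm_B st))"

text \<open>
  The interpolation step may choose any of several polynomials \<open>Q\<close>, so the algorithm is a relation:
  \<open>list_decoding \<alpha> m0 n k t m Py R out\<close> says that some run on \<open>R\<close> returns the list with
  set of members \<open>out\<close>. Failure is the empty list.

  The last branch has \<open>bm_L_Lambda st \<le> t\<close> and \<open>bm_L_B st + 1 \<le> t\<close>, and \<open>bm_L_Lambda st + bm_L_B st\<close>
  is \<open>n - k\<close>, so that no subtraction on \<^typ>\<open>nat\<close> is truncated. The term \<open>n - k + 1\<close> in the
  number of series coefficients is \<open>d\<close>, that is \<open>2 t\<^sub>0\<close>.
\<close>

definition list_decoding ::
  "'a::{field,finite} \<Rightarrow> int \<Rightarrow> nat \<Rightarrow> nat \<Rightarrow> nat \<Rightarrow> nat \<Rightarrow> nat \<Rightarrow> 'a poly \<Rightarrow> 'a poly set \<Rightarrow> bool" where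
  "list_decoding \<alpha> m0 n k t m Py R out \<longleftrightarrow>
     (let st = berlekamp_massey (syndrome \<alpha> m0 R) (n - k);
          \<Lambda> = bm_Lambda st; B = bm_B st; L\<^sub>\<Lambda> = bm_L_Lambda st; LxB = bm_L_B st + 1;
          w = int L\<^sub>\<Lambda> - int LxB
      in if L\<^sub>\<Lambda> > t then out = {}
         else if LxB > t then
           out = (if card (locator_roots \<alpha> n \<Lambda>) = L\<^sub>\<Lambda>
                  then {R - forney_error \<alpha> m0 n k R \<Lambda>} else {})
         else
           \<exists>Q. is_interpolant m Py w (interpolation_point \<alpha> \<Lambda> B ` {..<n}) Q \<and>
               out = {W. \<exists>s \<in> rational_factorization (3 * t + 1 - (n - k + 1) - L\<^sub>\<Lambda>) Q.
                           let \<Lambda>' = candidate_locator t st s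
                           in card (locator_roots \<alpha> n \<Lambda>') = degree \<Lambda>' \<and>
                              W = R - forney_error \<alpha> m0 n k R \<Lambda>' \<and>
                              W \<in> RS_code \<alpha> m0 n k \<and> hamming_dist R W \<le> t})"

end

theory Submission
  imports Defs
begin

text \<open>
  Any pair \<open>P, W\<close> with \<open>P S = W mod x^(n-k)\<close> is a polynomial combination of the two pairs
  maintained by the Berlekamp-Massey algorithm. For the error locator of a codeword at distance
  \<open>e \<le> t\<close> this gives \<open>lam \<Lambda> + b x B\<close> with \<open>deg lam \<le> e - L\<^sub>\<Lambda>\<close> and \<open>deg b \<le> e - LxB\<close>, so that
  the rational function \<open>b/lam\<close> takes the value \<open>y\<^sub>i\<close> at the error positions. The numerator of
  \<open>Q(x, b/lam)\<close> then has \<open>e\<close> zeros of multiplicity \<open>m\<close>, whereas its degree is smaller than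
  \<open>e m\<close>, because a count of coefficients bounds the minimum weighted degree of \<open>Q\<close>. Hence
  \<open>b/lam\<close> is a \<open>y\<close>-root of \<open>Q\<close>, its expansion is found by the rational factorization, and
  \<open>lam\<close> is recovered as the shortest linear recurrence of a segment of this expansion.
\<close>

section \<open>Key equations and the Berlekamp-Massey algorithm\<close>

text \<open>Substituting \<open>b/lam\<close> for \<open>y\<close> gives \<open>y\<close> the weight
  \<open>deg b - deg lam\<close>, and the bounds on these degrees differ by
  \<open>w = LL - LxB\<close>; hence the weighted degree, with \<open>w\<close> possibly negative.
  As \<open>LL + LxB = d\<close>, both lengths cancel from the counting condition, so
  \<open>m\<close> and \<open>Py\<close> can be fixed before \<open>R\<close> is known. At an error
  position where \<open>B\<close> vanishes, \<open>y\<close> is infinite. There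
  \<open>\<Lambda>\<close> is nonzero, as the determinant of the two computed pairs is a power of
  \<open>x\<close> up to sign, so \<open>lam\<close> vanishes; exchanging \<open>b\<close> and
  \<open>lam\<close> in the homogeneous numerator amounts to reversing \<open>Q\<close> in
  \<open>y\<close>. A shortest recurrence would lose any factor that \<open>lam\<close> shares with
  \<open>b\<close>. There is none, since nonzero error values make locator and evaluator coprime.
  Soundness is immediate in the last branch, which filters its candidates, but the branch
  \<open>LxB > t\<close> returns a word unchecked; there a locator with all its roots must be turned
  back into an error.\<close>

lemma coeff_mult_eq_0:
  fixes P Q :: "'a::comm_semiring_0 poly"
  assumes "\<forall>j\<ge>a. coeff P j = 0" and "\<forall>j\<ge>b. coeff Q j = 0" and "j + 1 \<ge> a + b"
  shows "coeff (P * Q) j = 0"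
  unfolding coeff_mult
proof (rule sum.neutral, intro ballI)
  fix i assume i: "i \<in> {..j}"
  show "coeff P i * coeff Q (j - i) = 0"
  proof (cases "i \<ge> a")
    case False
    then have "j - i \<ge> b" using assms(3) by simp
    then show ?thesis using assms(2) by simp
  qed (use assms(1) in simp)
qed

text \<open>The higher part \<open>V\<close> is an explicit witness because its constant term is the
  next discrepancy. \<open>W\<close> is bounded by vanishing coefficients rather than by
  \<open>degree W < e\<close>, so that \<open>e = 0\<close> still admits
  \<open>W = 0\<close>.\<close>

definition key_equation ::
  "'a::field fps \<Rightarrow> nat \<Rightarrow> nat \<Rightarrow> 'a poly \<Rightarrow> 'a poly \<Rightarrow> 'a fps \<Rightarrow> bool" where
  "key_equation f r e P W V \<longleftrightarrow>
     degree P \<le> e \<and> (\<forall>j\<ge>e. coeff W j = 0) \<and>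
     fps_of_poly P * f = fps_of_poly W + fps_X ^ r * V"

text \<open>Eliminating \<open>f\<close> leaves only terms from \<open>x^r\<close> on, while the
  lengths cut off everything from \<open>x^(e+e')\<close> on. With \<open>e + e' = r + 1\<close> a
  single monomial can survive.\<close>

lemma key_equation_determinant:
  assumes 1: "key_equation f r e P W V" and 2: "key_equation f r e' P' W' V'"
  shows "fps_of_poly (P * W' - P' * W) = fps_X ^ r * (fps_of_poly P' * V - fps_of_poly P * V')"
    and "\<forall>j\<ge>e + e'. coeff (P * W' - P' * W) j = 0"
proof -
  have W: "fps_of_poly W = fps_of_poly P * f - fps_X ^ r * V"
    "fps_of_poly W' = fps_of_poly P' * f - fps_X ^ r * V'"
    using 1 2 by (auto simp: key_equation_def)
  show "fps_of_poly (P * W' - P' * W) =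
      fps_X ^ r * (fps_of_poly P' * V - fps_of_poly P * V')"
    unfolding fps_of_poly_mult fps_of_poly_diff W by (simp add: algebra_simps)
  have a: "\<forall>j\<ge>e + 1. coeff P j = 0" "\<forall>j\<ge>e'. coeff W' j = 0"
    "\<forall>j\<ge>e' + 1. coeff P' j = 0" "\<forall>j\<ge>e. coeff W j = 0"
    using 1 2 by (auto simp: key_equation_def intro: coeff_eq_0)
  show "\<forall>j\<ge>e + e'. coeff (P * W' - P' * W) j = 0"
    using coeff_mult_eq_0[OF a(1,2)] coeff_mult_eq_0[OF a(3,4)] by auto
qed

text \<open>The discrepancy of the pair \<open>xB\<close> is normalised to 1, so that subtracting
  \<open>\<Delta> xB\<close> cancels the discrepancy \<open>\<Delta>\<close> of
  \<open>\<Lambda>\<close>. The lengths of the two pairs sum to \<open>r + 1\<close>. Minimality of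
  the length of \<open>\<Lambda>\<close> is a consequence, see
  \<open>bm_L_Lambda_le\<close>.\<close>

definition bm_invariant :: "'a::{field,finite} fps \<Rightarrow> nat \<Rightarrow> 'a bm_state \<Rightarrow> bool" where
  "bm_invariant f r st \<longleftrightarrow>
     bm_L_Lambda st + bm_L_B st = r \<and> coeff (bm_Lambda st) 0 = 1 \<and>
     (\<exists>\<Omega> V. key_equation f r (bm_L_Lambda st) (bm_Lambda st) \<Omega> V) \<and>
     (\<exists>\<Theta> U. key_equation f r (bm_L_B st + 1) ([:0, 1:] * bm_B st) \<Theta> U \<and> fps_nth U 0 = 1)"

lemma bm_invariantI:
  assumes "L + LB = r" and "coeff \<Lambda> 0 = 1" and "key_equation f r L \<Lambda> \<Omega> V"
    and "key_equation f r (LB + 1) ([:0, 1:] * B) \<Theta> U" and "fps_nth U 0 = 1"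
  shows "bm_invariant f r \<lparr>bm_Lambda = \<Lambda>, bm_B = B, bm_L_Lambda = L, bm_L_B = LB\<rparr>"
  unfolding bm_invariant_def bm_state.simps using assms by blast

lemma key_equation_diff:
  assumes "key_equation f r e P W V" and "key_equation f r e' P' W' V'"
    and "e \<le> e''" and "e' \<le> e''"
  shows "key_equation f r e'' (P - smult c P') (W - smult c W') (V - fps_const c * V')"
proof -
  have "degree (P - smult c P') \<le> e''"
    using assms by (intro degree_diff_le) (auto simp: key_equation_def intro: order.trans[OF degree_smult_le])
  moreover have "fps_of_poly (P - smult c P') * f =
      fps_of_poly P * f - fps_const c * (fps_of_poly P' * f)"
    by (simp add: fps_of_poly_diff fps_of_poly_smult algebra_simps)
  then have "fps_of_poly (P - smult c P') * f =
      (fps_of_poly W + fps_X ^ r * V) - fps_const c * (fps_of_poly W' + fps_X ^ r * V')"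
    using assms by (simp add: key_equation_def)
  ultimately show ?thesis
    using assms by (auto simp: key_equation_def fps_of_poly_diff fps_of_poly_smult algebra_simps)
qed

lemma key_equation_shift:
  assumes "key_equation f r e P W V"
  shows "key_equation f (Suc r) (Suc e) ([:0, 1:] * P) ([:0, 1:] * W) V"
proof -
  have "degree ([:0, 1:] * P) \<le> Suc e"
    using assms by (auto simp: key_equation_def degree_pCons_eq_if)
  moreover have "\<forall>j\<ge>Suc e. coeff ([:0, 1:] * W) j = 0"
    using assms by (auto simp: key_equation_def coeff_pCons split: nat.splits)
  moreover have "fps_of_poly ([:0, 1:] * P) = fps_X * fps_of_poly P" for P :: "'a poly"
    by (simp add: fps_of_poly_mult fps_of_poly_pCons)
  ultimately show ?thesis
    using assms unfolding key_equation_def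
    by (simp only: mult.assoc distrib_left power_Suc mult.left_commute[of _ fps_X])
qed

lemma key_equation_smult:
  assumes "key_equation f r e P W V"
  shows "key_equation f r e (smult c P) (smult c W) (fps_const c * V)"
proof -
  have "fps_const c * fps_of_poly P * f = fps_const c * (fps_of_poly W + fps_X ^ r * V)"
    using assms by (simp add: key_equation_def mult.assoc)
  then show ?thesis
    using assms by (auto simp: key_equation_def fps_of_poly_smult algebra_simps)
qed

lemma key_equation_Suc:
  assumes "key_equation f r e P W V" and "fps_nth V 0 = 0"
  shows "\<exists>V'. key_equation f (Suc r) e P W V'"
proof -
  have V: "fps_X * fps_shift 1 V = V"
    using assms(2) by (intro fps_ext) auto
  have "fps_X ^ Suc r * fps_shift 1 V = fps_X ^ r * (fps_X * fps_shift 1 V)"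
    by (simp only: power_Suc2 mult.assoc)
  then have "fps_X ^ r * V = fps_X ^ Suc r * fps_shift 1 V"
    unfolding V by (rule sym)
  then show ?thesis using assms(1) unfolding key_equation_def by metis
qed

text \<open>\<open>W\<close> does not reach the coefficient of \<open>x^r\<close> because
  \<open>e \<le> r\<close>, so this coefficient of \<open>P f\<close> is due to \<open>V\<close>
  alone.\<close>

lemma key_equation_discrepancy:
  assumes "key_equation (Abs_fps S) r e P W V" and "e \<le> r"
  shows "fps_nth V 0 = (\<Sum>i\<le>e. coeff P i * S (r - i))"
proof -
  have "fps_nth V 0 = fps_nth (fps_of_poly P * Abs_fps S) r"
    using assms by (simp add: key_equation_def fps_X_power_mult_nth)
  also have "\<dots> = (\<Sum>i=0..r. coeff P i * S (r - i))"
    by (simp add: fps_mult_nth)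
  also have "\<dots> = (\<Sum>i\<le>e. coeff P i * S (r - i))"
    using assms by (intro sum.mono_neutral_right) (auto simp: key_equation_def intro: coeff_eq_0)
  finally show ?thesis .
qed

text \<open>The corrected \<open>\<Lambda>\<close> needs the larger of the lengths \<open>L\<close>
  and \<open>LB + 1\<close>. As \<open>L + LB = r\<close>, the test \<open>2 * L \<le> r\<close>
  says \<open>L \<le> LB\<close>, which decides between them.\<close>

lemma bm_invariant_step:
  assumes "bm_invariant (Abs_fps S) r st"
  shows "bm_invariant (Abs_fps S) (Suc r) (bm_step S r st)"
proof -
  define \<Lambda> B L LB where st: "\<Lambda> = bm_Lambda st" "B = bm_B st" "L = bm_L_Lambda st" "LB = bm_L_B st"
  obtain \<Omega> V \<Theta> U where L: "L + LB = r" and c0: "coeff \<Lambda> 0 = 1"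
    and k1: "key_equation (Abs_fps S) r L \<Lambda> \<Omega> V"
    and k2: "key_equation (Abs_fps S) r (LB + 1) ([:0, 1:] * B) \<Theta> U" and U: "fps_nth U 0 = 1"
    using assms unfolding bm_invariant_def st by blast
  define \<Delta> where "\<Delta> = (\<Sum>i\<le>L. coeff \<Lambda> i * S (r - i))"
  have V0: "fps_nth V 0 = \<Delta>"
    unfolding \<Delta>_def using L by (intro key_equation_discrepancy[OF k1]) simp
  have c0': "coeff (\<Lambda> - smult \<Delta> ([:0, 1:] * B)) 0 = 1"
    using c0 by simp
  have new: "\<exists>V'. key_equation (Abs_fps S) (Suc r) e (\<Lambda> - smult \<Delta> ([:0, 1:] * B))
      (\<Omega> - smult \<Delta> \<Theta>) V'" if "L \<le> e" "LB + 1 \<le> e" for e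
    using key_equation_diff[OF k1 k2 that, of \<Delta>] V0 U by (intro key_equation_Suc) auto
  show ?thesis
  proof (cases "\<Delta> \<noteq> 0 \<and> 2 * L \<le> r")
    case True
    then have step: "bm_step S r st = \<lparr>bm_Lambda = \<Lambda> - smult \<Delta> ([:0, 1:] * B),
        bm_B = smult (inverse \<Delta>) \<Lambda>, bm_L_Lambda = LB + 1, bm_L_B = L\<rparr>"
      by (simp add: bm_step_def \<Delta>_def st Let_def)
    obtain V' where V': "key_equation (Abs_fps S) (Suc r) (LB + 1) (\<Lambda> - smult \<Delta> ([:0, 1:] * B))
      (\<Omega> - smult \<Delta> \<Theta>) V'"
      using new[of "LB + 1"] True L by auto
    show ?thesis
      unfolding step
    proof (rule bm_invariantI[OF _ c0' V'])
      \<comment> \<open>Scaling by \<open>inverse \<Delta>\<close> gives the old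
        \<open>\<Lambda>\<close> discrepancy 1, and multiplying by \<open>x\<close> raises
        \<open>r\<close> without touching the higher part.\<close>
      show "key_equation (Abs_fps S) (Suc r) (L + 1) ([:0, 1:] * smult (inverse \<Delta>) \<Lambda>)
          ([:0, 1:] * smult (inverse \<Delta>) \<Omega>) (fps_const (inverse \<Delta>) * V)"
        using key_equation_shift[OF key_equation_smult[OF k1]] by simp
    qed (use L True V0 in auto)
  next
    case False
    then have step: "bm_step S r st = \<lparr>bm_Lambda = \<Lambda> - smult \<Delta> ([:0, 1:] * B),
        bm_B = [:0, 1:] * B, bm_L_Lambda = L, bm_L_B = LB + 1\<rparr>"
      unfolding bm_step_def \<Delta>_def st Let_def by (simp only: if_False)
    obtain W V' where V': "key_equation (Abs_fps S) (Suc r) L (\<Lambda> - smult \<Delta> ([:0, 1:] * B)) W V'"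
    proof (cases "\<Delta> = 0")
      case True
      then show thesis using key_equation_Suc[OF k1] V0 that by auto
    next
      case False
      then show thesis using \<open>\<not> (\<Delta> \<noteq> 0 \<and> 2 * L \<le> r)\<close> L new[of L] that by auto
    qed
    show ?thesis
      unfolding step using L key_equation_shift[OF k2] U
      by (intro bm_invariantI[OF _ c0' V']) simp_all
  qed
qed

lemma bm_invariant_berlekamp_massey:
  "bm_invariant (Abs_fps S) r (berlekamp_massey S r)"
proof (induction r)
  case 0
  have "key_equation (Abs_fps S) 0 0 1 0 (Abs_fps S)"
    by (simp add: key_equation_def)
  \<comment> \<open>At \<open>r = 0\<close> the split between \<open>W\<close> and \<open>V\<close>
    is free within the length 1; \<open>W = -1\<close> gives \<open>V\<close> the required constant
    term 1.\<close>
  moreover have "key_equation (Abs_fps S) 0 (0 + 1) ([:0, 1:] * 1) (- 1) (1 + fps_X * Abs_fps S)"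
    by (auto simp: key_equation_def fps_of_poly_pCons fps_of_poly_uminus)
  ultimately show ?case
    unfolding berlekamp_massey.simps by (rule bm_invariantI[rotated 2]) simp_all
qed (simp add: bm_invariant_step)

text \<open>
  The determinant \<open>\<Lambda>\<Theta> - xB\<Omega>\<close> equals \<open>-x^r\<close>, so that any solution of the key equation is
  a polynomial combination of the two computed ones; \<open>lam\<close> and \<open>b\<close> are given by Cramer's rule.
\<close>

lemma bm_solution_decomposition:
  fixes st :: "'a::{field,finite} bm_state"
  assumes inv: "bm_invariant f r st" and k: "key_equation f r e P W Z"
  obtains lam b \<Omega> \<Theta> V where
    "key_equation f r (bm_L_Lambda st) (bm_Lambda st) \<Omega> V"
    "P = lam * bm_Lambda st + b * ([:0, 1:] * bm_B st)" "W = lam * \<Omega> + b * \<Theta>"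
    "\<forall>j. j + bm_L_Lambda st > e \<longrightarrow> coeff lam j = 0"
    "\<forall>j. j + (bm_L_B st + 1) > e \<longrightarrow> coeff b j = 0"
    "\<exists>U V. U * bm_Lambda st + V * ([:0, 1:] * bm_B st) = monom 1 r"
proof -
  define \<Lambda> xB L LB where st: "\<Lambda> = bm_Lambda st" "xB = [:0, 1:] * bm_B st" "L = bm_L_Lambda st"
    "LB = bm_L_B st"
  obtain \<Omega> V \<Theta> U where L: "L + LB = r" and c0: "coeff \<Lambda> 0 = 1"
    and k1: "key_equation f r L \<Lambda> \<Omega> V"
    and k2: "key_equation f r (LB + 1) xB \<Theta> U" and U: "fps_nth U 0 = 1"
    using inv unfolding bm_invariant_def st by blast
  have monom_dvd: "monom 1 r dvd A" if "fps_of_poly A = fps_X ^ r * G" for A :: "'a poly" and G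
  proof -
    have "coeff A j = 0" if "j < r" for j
      using \<open>fps_of_poly A = _\<close> that by (metis fps_of_poly_nth fps_X_power_mult_nth)
    then show ?thesis by (simp add: monom_1_dvd_iff')
  qed
  have det: "\<Lambda> * \<Theta> - xB * \<Omega> = - monom 1 r"
  proof (rule poly_eqI)
    fix j
    have "coeff (\<Lambda> * \<Theta> - xB * \<Omega>) j =
        fps_nth (fps_X ^ r * (fps_of_poly xB * V - fps_of_poly \<Lambda> * U)) j"
      by (metis fps_of_poly_nth key_equation_determinant(1)[OF k1 k2])
    then have "coeff (\<Lambda> * \<Theta> - xB * \<Omega>) j = (if j < r then 0 else - 1)" if "j \<le> r"
      using that c0 U by (auto simp: fps_X_power_mult_nth st)
    moreover have "coeff (\<Lambda> * \<Theta> - xB * \<Omega>) j = 0" if "j > r"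
      using key_equation_determinant(2)[OF k1 k2] that L by auto
    ultimately show "coeff (\<Lambda> * \<Theta> - xB * \<Omega>) j = coeff (- monom 1 r) j"
      by (cases j r rule: linorder_cases) auto
  qed
  obtain lam where lam: "P * \<Theta> - xB * W = monom 1 r * (- lam)"
    using monom_dvd[OF key_equation_determinant(1)[OF k k2]] by (metis dvd_def minus_minus)
  obtain b where b: "\<Lambda> * W - P * \<Omega> = monom 1 r * (- b)"
    using monom_dvd[OF key_equation_determinant(1)[OF k1 k]] by (metis dvd_def minus_minus)
  have "monom 1 r * P = - (\<Lambda> * \<Theta> - xB * \<Omega>) * P" unfolding det by simp
  also have "\<dots> = - ((P * \<Theta> - xB * W) * \<Lambda> + (\<Lambda> * W - P * \<Omega>) * xB)"
    by (simp add: algebra_simps)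
  also have "\<dots> = monom 1 r * (lam * \<Lambda> + b * xB)"
    unfolding lam b by (simp add: algebra_simps)
  finally have P: "P = lam * \<Lambda> + b * xB" by simp
  have "monom 1 r * W = - (\<Lambda> * \<Theta> - xB * \<Omega>) * W" unfolding det by simp
  also have "\<dots> = - ((P * \<Theta> - xB * W) * \<Omega> + (\<Lambda> * W - P * \<Omega>) * \<Theta>)"
    by (simp add: algebra_simps)
  also have "\<dots> = monom 1 r * (lam * \<Omega> + b * \<Theta>)"
    unfolding lam b by (simp add: algebra_simps)
  finally have W: "W = lam * \<Omega> + b * \<Theta>" by simp
  have "coeff lam j = 0" if "j + L > e" for j
  proof -
    have "coeff (P * \<Theta> - xB * W) (j + r) = 0"
      using key_equation_determinant(2)[OF k k2] that L by auto
    then show ?thesis unfolding lam by (simp add: coeff_monom_mult)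
  qed
  moreover have "coeff b j = 0" if "j + (LB + 1) > e" for j
  proof -
    have "coeff (\<Lambda> * W - P * \<Omega>) (j + r) = 0"
      using key_equation_determinant(2)[OF k1 k] that L by auto
    then show ?thesis unfolding b by (simp add: coeff_monom_mult)
  qed
  \<comment> \<open>Away from 0, \<open>\<Lambda>\<close> and \<open>xB\<close> thus have no common
    zero, as needed where \<open>y\<close> is infinite.\<close>
  moreover have "(- \<Theta>) * \<Lambda> + \<Omega> * xB = monom 1 r" using det by (simp add: algebra_simps)
  ultimately show thesis
    using that[OF k1[unfolded st], of lam b \<Theta>] P W unfolding st by blast
qed

text \<open>If \<open>e < bm_L_Lambda st\<close>, no coefficient of \<open>lam\<close> survives, so
  \<open>P\<close> would be a multiple of \<open>xB\<close> and vanish at 0. This makes the failure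
  branch \<open>LL > t\<close> safe.\<close>

lemma bm_L_Lambda_le:
  assumes inv: "bm_invariant f r st" and k: "key_equation f r e P W Z" and "coeff P 0 = 1"
  shows "bm_L_Lambda st \<le> e"
proof (rule ccontr)
  assume less: "\<not> bm_L_Lambda st \<le> e"
  from bm_solution_decomposition[OF inv k] obtain lam b
    where P: "P = lam * bm_Lambda st + b * ([:0, 1:] * bm_B st)"
      and lam: "\<forall>j. j + bm_L_Lambda st > e \<longrightarrow> coeff lam j = 0" by metis
  have "lam = 0" using lam less by (intro poly_eqI) simp
  then have "coeff P 0 = 0" unfolding P by (simp add: coeff_mult_0)
  then show False using assms(3) by simp
qed

text \<open>\<open>e \<le> bm_L_B st\<close> leaves no room for \<open>b\<close>, so
  \<open>lam\<close> is a common factor of \<open>P\<close> and \<open>W\<close>, hence constant,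
  and \<open>P(0) = 1\<close> fixes the constant.\<close>

lemma bm_solution_unique:
  fixes st :: "'a::{field,finite} bm_state"
  assumes inv: "bm_invariant f r st" and k: "key_equation f r e P W Z" and P0: "coeff P 0 = 1"
    and e: "e \<le> bm_L_B st" and coprime: "\<And>D. D dvd P \<Longrightarrow> D dvd W \<Longrightarrow> is_unit D"
  shows "bm_Lambda st = P"
proof -
  from bm_solution_decomposition[OF inv k] obtain lam b \<Omega> \<Theta>
    where P: "P = lam * bm_Lambda st + b * ([:0, 1:] * bm_B st)" and W: "W = lam * \<Omega> + b * \<Theta>"
      and b: "\<forall>j. j + (bm_L_B st + 1) > e \<longrightarrow> coeff b j = 0" by metis
  have b0: "b = 0" using b e by (intro poly_eqI) simp
  have "is_unit lam" by (rule coprime) (simp_all add: P W b0)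
  then obtain c where c: "lam = [:c:]" by (auto simp: is_unit_poly_iff)
  have "coeff (bm_Lambda st) 0 = 1" using inv by (simp add: bm_invariant_def)
  then have "c = 1" using P0 by (simp add: P b0 c)
  then show ?thesis by (simp add: P b0 c one_pCons)
qed

text \<open>Cutting \<open>p\<close> at \<open>x^N\<close> as \<open>p0 + x^N \<sigma>\<close> turns
  the approximation of \<open>b\<close> by \<open>p lam\<close> into
  \<open>\<sigma> lam \<equiv> \<omega>\<close> modulo \<open>x^M\<close>, with
  \<open>\<omega> = (b - p0 lam) / x^N\<close>. Since \<open>b\<close> and \<open>p0 lam\<close> end
  before \<open>x^(N + deg lam)\<close>, the pair \<open>(lam, \<omega>)\<close> solves the key
  equation of the segment with length \<open>deg lam\<close>, and \<open>2 deg lam \<le> M\<close>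
  gives uniqueness. As \<open>deg b < N\<close>, reducing \<open>p lam\<close> modulo
  \<open>x^N\<close> returns \<open>b\<close> itself.\<close>

lemma candidate_locator_eq:
  fixes st :: "'a::{field,finite} bm_state"
  assumes lam0: "coeff lam 0 = 1"
    and lam: "\<forall>j. j + bm_L_Lambda st > t \<longrightarrow> coeff lam j = 0"
    and b: "\<forall>j. j + (bm_L_B st + 1) > t \<longrightarrow> coeff b j = 0"
    and t: "bm_L_Lambda st \<le> t" "bm_L_B st + 1 \<le> t"
    and coprime: "U * lam + V * b = 1"
    and p: "monom 1 (t - (bm_L_B st + 1) + 1 + 2 * (t - bm_L_Lambda st)) dvd b - p * lam"
  shows "candidate_locator t st p = lam * bm_Lambda st + b * ([:0, 1:] * bm_B st)"
proof -
  define N where "N = t - (bm_L_B st + 1) + 1"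
  define M where "M = 2 * (t - bm_L_Lambda st)"
  define bm where "bm = berlekamp_massey (\<lambda>j. coeff p (N + j)) M"
  define \<sigma> where "\<sigma> = poly_shift N p"
  define p0 where "p0 = poly_cutoff N p"
  obtain h where h: "b - p * lam = monom 1 (N + M) * h"
    using p by (auto simp: N_def M_def elim: dvdE)
  have split: "p = p0 + monom 1 N * \<sigma>"
    by (rule poly_eqI) (simp add: p0_def \<sigma>_def coeff_poly_cutoff coeff_poly_shift coeff_monom_mult)
  define \<omega> where "\<omega> = \<sigma> * lam + monom 1 M * h"
  have "p * lam = p0 * lam + monom 1 N * (\<sigma> * lam)"
    using arg_cong[OF split, of "\<lambda>q. q * lam"] by (simp add: distrib_right mult.assoc)
  then have "b - p0 * lam = monom 1 N * (\<sigma> * lam) + (b - p * lam)" by simp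
  also have "\<dots> = monom 1 N * \<omega>"
    unfolding h \<omega>_def by (simp add: distrib_left mult.assoc[symmetric] mult_monom)
  finally have \<omega>: "b - p0 * lam = monom 1 N * \<omega>" .
  have deg: "degree lam \<le> t - bm_L_Lambda st"
    using lam t by (intro degree_le) auto
  have "coeff \<omega> j = 0" if "j \<ge> degree lam" for j
  proof -
    have "coeff (p0 * lam) (N + j) = 0"
      using that by (intro coeff_mult_eq_0[of N _ "Suc (degree lam)"])
        (auto simp: p0_def coeff_poly_cutoff coeff_eq_0)
    moreover have "coeff b (N + j) = 0" using b t by (simp add: N_def)
    ultimately have "coeff (b - p0 * lam) (N + j) = 0" by simp
    then show ?thesis unfolding \<omega> by (simp add: coeff_monom_mult)
  qed
  moreover have "fps_of_poly lam * Abs_fps (\<lambda>j. coeff p (N + j)) =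
      fps_of_poly \<omega> + fps_X ^ M * (- fps_of_poly h)"
  proof -
    have "Abs_fps (\<lambda>j. coeff p (N + j)) = fps_of_poly \<sigma>"
      by (rule fps_ext) (simp add: \<sigma>_def coeff_poly_shift add.commute)
    then show ?thesis
      by (simp add: \<omega>_def fps_of_poly_add fps_of_poly_mult fps_of_poly_monom' mult.commute)
  qed
  ultimately have key: "key_equation (Abs_fps (\<lambda>j. coeff p (N + j))) M (degree lam) lam \<omega> (- fps_of_poly h)"
    by (simp add: key_equation_def)
  have inv: "bm_invariant (Abs_fps (\<lambda>j. coeff p (N + j))) M bm"
    unfolding bm_def by (rule bm_invariant_berlekamp_massey)
  have "bm_L_Lambda bm \<le> degree lam" by (rule bm_L_Lambda_le[OF inv key lam0])
  moreover have "bm_L_Lambda bm + bm_L_B bm = M" using inv by (simp add: bm_invariant_def)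
  ultimately have "degree lam \<le> bm_L_B bm" using deg by (simp add: M_def)
  then have bm_lam: "bm_Lambda bm = lam"
  proof (rule bm_solution_unique[OF inv key lam0])
    fix D assume "D dvd lam" "D dvd \<omega>"
    moreover have "b = p0 * lam + monom 1 N * \<omega>" using \<omega> by (simp add: algebra_simps)
    ultimately have "D dvd U * lam + V * b" by simp
    then show "is_unit D" by (simp add: coprime)
  qed
  have "monom 1 N dvd b - p * lam"
    unfolding h by (metis dvd_mult2 dvd_triv_left mult.right_neutral mult_monom)
  then have "b mod monom 1 N = (p * lam) mod monom 1 N"
    by (simp add: mod_eq_dvd_iff)
  moreover have "b mod monom 1 N = b"
  proof (rule mod_poly_less)
    have "degree b \<le> N - 1" using b t by (intro degree_le) (auto simp: N_def)
    then show "degree b < degree (monom (1 :: 'a) N)" by (simp add: degree_monom_eq N_def)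
  qed
  ultimately show ?thesis
    unfolding candidate_locator_def Let_def N_def[symmetric] M_def[symmetric] bm_def[symmetric] bm_lam
    by simp
qed

section \<open>Error locators and Forney's formula\<close>

lemma prod_linear_power_dvd:
  fixes F :: "'a::idom poly"
  assumes "finite A" and "\<forall>a\<in>A. [:- a, 1:] ^ m dvd F"
  shows "(\<Prod>a\<in>A. [:- a, 1:] ^ m) dvd F"
  using assms
proof (induction A rule: finite_induct)
  case (insert a A)
  then obtain G where G: "F = (\<Prod>a\<in>A. [:- a, 1:] ^ m) * G" by auto
  show ?case
  proof (cases "F = 0")
    case False
    then have nz: "(\<Prod>a\<in>A. [:- a, 1:] ^ m) * G \<noteq> 0" using G by simp
    have "poly (\<Prod>a\<in>A. [:- a, 1:] ^ m) a \<noteq> 0"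
      using insert.hyps by (auto simp: poly_prod)
    then have "order a F = order a G"
      unfolding G order_mult[OF nz] by (simp add: order_0I)
    then have "[:- a, 1:] ^ m dvd G"
      using insert.prems False by (auto simp: order_divides)
    then show ?thesis
      using insert.hyps unfolding G by (simp add: mult.commute mult_dvd_mono)
  qed simp
qed simp

lemma prod_linear_power_degree:
  fixes F :: "'a::idom poly"
  assumes "finite A" and "\<forall>a\<in>A. [:- a, 1:] ^ m dvd F" and "F \<noteq> 0"
  shows "m * card A \<le> degree F"
proof -
  have "degree (\<Prod>a\<in>A. [:- a, 1:] ^ m) = (\<Sum>a\<in>A. m)"
    by (subst degree_prod_eq_sum_degree) (auto simp: degree_power_eq)
  then show ?thesis
    using dvd_imp_degree_le[OF prod_linear_power_dvd[OF assms(1,2)] assms(3)] by (simp add: mult.commute)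
qed

section \<open>Powers of a primitive element\<close>

lemma primitive_element_nonzero:
  assumes "primitive_element \<alpha>"
  shows "\<alpha> \<noteq> 0"
proof -
  have "\<alpha> ^ 1 \<in> UNIV - {0}"
    using assms unfolding primitive_element_def by blast
  then show ?thesis by simp
qed

text \<open>A relation \<open>\<alpha>^l = 1\<close> with \<open>0 < l < q - 1\<close> would leave
  at most \<open>l\<close> distinct powers, too few for the \<open>q - 1\<close> nonzero
  elements.\<close>

lemma primitive_element_inj:
  fixes \<alpha> :: "'a::{field,finite}"
  assumes "primitive_element \<alpha>"
  shows "inj_on (\<lambda>i::nat. \<alpha> ^ i) {..<CARD('a) - 1}"
proof (rule linorder_inj_onI')
  fix i j :: nat assume ij: "i \<in> {..<CARD('a) - 1}" "j \<in> {..<CARD('a) - 1}" "i < j"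
  show "\<alpha> ^ i \<noteq> \<alpha> ^ j"
  proof
    assume eq: "\<alpha> ^ i = \<alpha> ^ j"
    define l where "l = j - i"
    have l: "l > 0" "l < CARD('a) - 1" and "\<alpha> ^ j = \<alpha> ^ i * \<alpha> ^ l"
      using ij by (auto simp: l_def simp flip: power_add)
    then have one: "\<alpha> ^ l = 1" using eq primitive_element_nonzero[OF assms] by simp
    have "\<alpha> ^ s = \<alpha> ^ (s mod l)" for s
    proof -
      have "\<alpha> ^ s = \<alpha> ^ (l * (s div l) + s mod l)" by simp
      also have "\<dots> = \<alpha> ^ (s mod l)"
        unfolding power_add power_mult one by simp
      finally show ?thesis .
    qed
    then have "range (\<lambda>i::nat. \<alpha> ^ i) \<subseteq> (\<lambda>i. \<alpha> ^ i) ` {..<l}"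
      using l by (metis (no_types, lifting) image_eqI image_subsetI lessThan_iff mod_less_divisor)
    then have sub: "UNIV - {0} \<subseteq> (\<lambda>i. \<alpha> ^ i) ` {..<l}"
      using assms by (simp add: primitive_element_def)
    have "card (UNIV - {0 :: 'a}) \<le> card ((\<lambda>i. \<alpha> ^ i) ` {..<l})"
      by (rule card_mono[OF _ sub]) simp
    also have "\<dots> \<le> l"
      using card_image_le[of "{..<l}" "\<lambda>i. \<alpha> ^ i"] by simp
    finally have "card (UNIV - {0 :: 'a}) \<le> l" .
    then show False using l by (simp add: card_Diff_singleton)
  qed
qed

section \<open>Locators, evaluators and syndrome series\<close>

definition locator :: "'a::field \<Rightarrow> nat set \<Rightarrow> 'a poly" where
  "locator \<alpha> I = (\<Prod>i\<in>I. [:1, - (\<alpha> ^ i):])"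

text \<open>The numerator of the sum of \<open>E_i X_i^m0 / (1 - X_i x)\<close>, where
  \<open>X_i = \<alpha>^i\<close>, over the common denominator
  \<open>locator \<alpha> I\<close>.\<close>

definition evaluator :: "'a::field \<Rightarrow> int \<Rightarrow> nat set \<Rightarrow> 'a poly \<Rightarrow> 'a poly" where
  "evaluator \<alpha> m0 I E =
     (\<Sum>i\<in>I. smult (coeff E i * (\<alpha> ^ i) powi m0) (locator \<alpha> (I - {i})))"

definition syndrome_series :: "'a::field \<Rightarrow> int \<Rightarrow> 'a poly \<Rightarrow> 'a fps" where
  "syndrome_series \<alpha> m0 E = Abs_fps (\<lambda>j. poly E (\<alpha> powi (int j + m0)))"

lemma coeff_locator_0 [simp]: "coeff (locator \<alpha> I) 0 = 1"
  by (simp add: locator_def poly_prod flip: poly_0_coeff_0)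

lemma locator_remove:
  "finite I \<Longrightarrow> i \<in> I \<Longrightarrow> locator \<alpha> I = [:1, - (\<alpha> ^ i):] * locator \<alpha> (I - {i})"
  unfolding locator_def by (rule prod.remove)

lemma poly_locator: "poly (locator \<alpha> I) x = (\<Prod>i\<in>I. 1 - \<alpha> ^ i * x)"
  by (simp add: locator_def poly_prod mult.commute)

lemma degree_locator:
  assumes "\<alpha> \<noteq> 0"
  shows "degree (locator \<alpha> I) = card I"
  using assms unfolding locator_def
  by (subst degree_prod_eq_sum_degree) auto

lemma fps_geometric: "fps_of_poly [:1, - a:] * Abs_fps (\<lambda>j. a ^ j) = (1 :: 'a::field fps)"
proof (rule fps_ext)
  fix j
  have "fps_of_poly [:1, - a:] * Abs_fps (\<lambda>j. a ^ j) =
      Abs_fps (\<lambda>j. a ^ j) - fps_const a * (fps_X * Abs_fps (\<lambda>j. a ^ j))"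
    by (simp add: fps_of_poly_pCons algebra_simps flip: fps_const_neg)
  then show "fps_nth (fps_of_poly [:1, - a:] * Abs_fps (\<lambda>j. a ^ j)) j = fps_nth 1 j"
    by (cases j) auto
qed

text \<open>Exchanging the two sums writes the series as a combination of geometric series
  \<open>1 / (1 - X_i x)\<close>, and each denominator is a factor of the locator.\<close>

lemma locator_mult_syndrome_series:
  assumes "\<alpha> \<noteq> 0" and "finite I" and "\<forall>i. i \<notin> I \<longrightarrow> coeff E i = 0"
  shows "fps_of_poly (locator \<alpha> I) * syndrome_series \<alpha> m0 E = fps_of_poly (evaluator \<alpha> m0 I E)"
proof -
  have pE: "poly E x = (\<Sum>i\<in>I. coeff E i * x ^ i)" for x
  proof -
    have "poly E x = (\<Sum>i\<le>degree E. coeff E i * x ^ i)" by (rule poly_altdef)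
    also have "\<dots> = (\<Sum>i\<in>I. coeff E i * x ^ i)"
      using assms by (intro sum.mono_neutral_cong) (auto simp: coeff_eq_0)
    finally show ?thesis .
  qed
  have pw: "(\<alpha> powi (int j + m0)) ^ i = (\<alpha> ^ i) powi m0 * (\<alpha> ^ i) ^ j" for i j :: nat
  proof -
    have "(\<alpha> powi m0) ^ i = (\<alpha> ^ i) powi m0"
      by (metis mult.commute power_int_mult power_int_of_nat)
    moreover have "(\<alpha> ^ j) ^ i = (\<alpha> ^ i) ^ j"
      by (simp add: mult.commute flip: power_mult)
    ultimately show ?thesis
      using assms(1) by (simp add: power_int_add power_mult_distrib)
  qed
  have series: "syndrome_series \<alpha> m0 E =
      (\<Sum>i\<in>I. fps_const (coeff E i * (\<alpha> ^ i) powi m0) * Abs_fps (\<lambda>j. (\<alpha> ^ i) ^ j))"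
    by (rule fps_ext) (simp add: syndrome_series_def fps_sum_nth pE pw mult.assoc)
  have "fps_of_poly (locator \<alpha> I) * Abs_fps (\<lambda>j. (\<alpha> ^ i) ^ j) = fps_of_poly (locator \<alpha> (I - {i}))"
    if "i \<in> I" for i
  proof -
    have "fps_of_poly (locator \<alpha> I) * Abs_fps (\<lambda>j. (\<alpha> ^ i) ^ j) =
        (fps_of_poly [:1, - (\<alpha> ^ i):] * Abs_fps (\<lambda>j. (\<alpha> ^ i) ^ j)) * fps_of_poly (locator \<alpha> (I - {i}))"
      by (simp only: locator_remove[OF assms(2) that] fps_of_poly_mult mult_ac)
    then show ?thesis unfolding fps_geometric by simp
  qed
  then show ?thesis
    unfolding series evaluator_def sum_distrib_left fps_of_poly_sum fps_of_poly_smult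
    by (intro sum.cong refl) (simp add: mult.left_commute)
qed

lemma coeff_evaluator_eq_0:
  assumes "\<alpha> \<noteq> 0" and "finite I" and "j \<ge> card I"
  shows "coeff (evaluator \<alpha> m0 I E) j = 0"
proof -
  have "coeff (locator \<alpha> (I - {i})) j = 0" if "i \<in> I" for i
  proof (rule coeff_eq_0)
    have "card (I - {i}) < card I" using that assms(2) by (intro psubset_card_mono) auto
    then show "degree (locator \<alpha> (I - {i})) < j"
      using assms(3) by (simp add: degree_locator[OF assms(1)])
  qed
  then show ?thesis by (simp add: evaluator_def coeff_sum)
qed

lemma key_equation_locator:
  assumes "\<alpha> \<noteq> 0" and "finite I" and "\<forall>i. i \<notin> I \<longrightarrow> coeff E i = 0"
    and "\<forall>j<r. fps_nth f j = poly E (\<alpha> powi (int j + m0))"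
  shows "\<exists>V. key_equation f r (card I) (locator \<alpha> I) (evaluator \<alpha> m0 I E) V"
proof -
  have "f - syndrome_series \<alpha> m0 E = fps_X ^ r * fps_shift r (f - syndrome_series \<alpha> m0 E)"
    using assms(4) by (intro fps_ext) (auto simp: fps_X_power_mult_nth syndrome_series_def)
  then have f: "f = syndrome_series \<alpha> m0 E + fps_X ^ r * fps_shift r (f - syndrome_series \<alpha> m0 E)"
    by (metis add.commute diff_add_cancel)
  have "fps_of_poly (locator \<alpha> I) * f = fps_of_poly (evaluator \<alpha> m0 I E) +
      fps_X ^ r * (fps_of_poly (locator \<alpha> I) * fps_shift r (f - syndrome_series \<alpha> m0 E))"
    by (subst f) (simp add: distrib_left locator_mult_syndrome_series[OF assms(1-3)] mult.left_commute)
  then show ?thesis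
    using coeff_evaluator_eq_0[OF assms(1,2)] degree_locator[OF assms(1)]
    unfolding key_equation_def by (metis order_refl)
qed

text \<open>A Bezout identity, since \<^typ>\<open>'a poly\<close> has no gcd for an arbitrary field \<^typ>\<open>'a\<close>.\<close>

lemma locator_bezout:
  fixes B :: "'a::field poly"
  assumes "\<alpha> \<noteq> 0" and "finite I" and "\<forall>i\<in>I. poly B (inverse (\<alpha> ^ i)) \<noteq> 0"
  shows "\<exists>U V. U * locator \<alpha> I + V * B = 1"
  using assms(2,3)
proof (induction I rule: finite_induct)
  case empty
  show ?case by (rule exI[of _ 1], rule exI[of _ 0]) (simp add: locator_def)
next
  case (insert i I)
  then obtain U V where UV: "U * locator \<alpha> I + V * B = 1" by auto
  define c where "c = poly B (inverse (\<alpha> ^ i))"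
  have c: "c \<noteq> 0" using insert.prems by (simp add: c_def)
  have "poly (B - [:c:]) (inverse (\<alpha> ^ i)) = 0" by (simp add: c_def)
  then obtain q where q0: "B - [:c:] = [:- inverse (\<alpha> ^ i), 1:] * q"
    unfolding poly_eq_0_iff_dvd by (elim dvdE)
  have lin: "[:- inverse (\<alpha> ^ i), 1:] = smult (- inverse (\<alpha> ^ i)) [:1, - (\<alpha> ^ i):]"
    using assms(1) by simp
  have "[:c:] = B - (B - [:c:])" by (simp only: diff_diff_eq2 add_diff_cancel_left')
  also have "\<dots> = B - smult (- inverse (\<alpha> ^ i)) [:1, - (\<alpha> ^ i):] * q"
    unfolding q0 lin ..
  finally have q: "[:c:] = B - smult (- inverse (\<alpha> ^ i)) [:1, - (\<alpha> ^ i):] * q" .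
  define U' where "U' = smult (inverse c) (smult (inverse (\<alpha> ^ i)) q)"
  define V' where "V' = [:inverse c:]"
  have "1 = [:inverse c:] * [:c:]" using c by (simp add: one_pCons)
  also have "\<dots> = [:inverse c:] * B + smult (inverse c) (smult (inverse (\<alpha> ^ i)) [:1, - (\<alpha> ^ i):] * q)"
    unfolding q by (simp only: right_diff_distrib smult_minus_left mult_minus_left diff_minus_eq_add)
      (simp add: smult_add_right)
  finally have UV': "U' * [:1, - (\<alpha> ^ i):] + V' * B = 1"
    by (simp only: U'_def V'_def mult_smult_left mult_smult_right add.commute mult.commute[of _ q])
  \<comment> \<open>In the product of the identities for \<open>I\<close> and for the new linear
    factor, every term except the one with \<open>U * U'\<close> contains \<open>B\<close>.\<close>
  have "(U * locator \<alpha> I + V * B) * (U' * [:1, - (\<alpha> ^ i):] + V' * B) = 1"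
    unfolding UV UV' by simp
  then have "(U * U') * ([:1, - (\<alpha> ^ i):] * locator \<alpha> I) +
      (U * locator \<alpha> I * V' + V * (U' * [:1, - (\<alpha> ^ i):]) + V * V' * B) * B = 1"
    by (simp only: distrib_left distrib_right mult_ac add_ac)
  moreover have "locator \<alpha> (insert i I) = [:1, - (\<alpha> ^ i):] * locator \<alpha> I"
    using insert.hyps by (simp add: locator_def)
  ultimately show ?case by metis
qed

section \<open>Locator roots, Forney's formula and codewords\<close>

locale rs_positions =
  fixes \<alpha> :: "'a::{field,finite}" and n :: nat
  assumes nonzero: "\<alpha> \<noteq> 0" and inj: "inj_on (\<lambda>i. \<alpha> ^ i) {..<n}"
begin

lemma eval_point [simp]: "\<alpha> powi (- int i) = inverse (\<alpha> ^ i)"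
  by (simp add: power_int_minus)

lemma eval_point_inj: "inj_on (\<lambda>i. inverse (\<alpha> ^ i)) {..<n}"
  using inj by (auto simp: inj_on_def)

lemma poly_locator_eq_0_iff:
  assumes "I \<subseteq> {..<n}" and "i < n"
  shows "poly (locator \<alpha> I) (inverse (\<alpha> ^ i)) = 0 \<longleftrightarrow> i \<in> I"
proof -
  have "1 - \<alpha> ^ j * inverse (\<alpha> ^ i) = 0 \<longleftrightarrow> i = j" if "j \<in> I" for j
  proof -
    have "1 - \<alpha> ^ j * inverse (\<alpha> ^ i) = 0 \<longleftrightarrow> \<alpha> ^ i = \<alpha> ^ j"
      using nonzero by (auto simp: field_simps)
    also have "\<dots> \<longleftrightarrow> i = j" using inj assms that by (auto simp: inj_on_def)
    finally show ?thesis .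
  qed
  moreover have "finite I" using assms(1) finite_subset by blast
  ultimately show ?thesis by (auto simp: poly_locator)
qed

lemma error_positions_locator:
  assumes "I \<subseteq> {..<n}"
  shows "error_positions \<alpha> n (locator \<alpha> I) = I"
  using assms poly_locator_eq_0_iff[OF assms] by (auto simp: error_positions_def)

lemma locator_roots_eq: "locator_roots \<alpha> n P = (\<lambda>i. inverse (\<alpha> ^ i)) ` error_positions \<alpha> n P"
  by (auto simp: locator_roots_def error_positions_def)

lemma card_locator_roots: "card (locator_roots \<alpha> n P) = card (error_positions \<alpha> n P)"
  unfolding locator_roots_eq
  by (rule card_image, rule inj_on_subset[OF eval_point_inj]) (auto simp: error_positions_def)

text \<open>Zeros at \<open>card I\<close> points, \<open>I\<close> being the set of error
  positions, and the value 1 at 0 determine a polynomial of degree at most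
  \<open>card I\<close>.\<close>

lemma locator_error_positions:
  assumes "coeff P 0 = 1" and "degree P \<le> card (error_positions \<alpha> n P)"
  shows "P = locator \<alpha> (error_positions \<alpha> n P)"
proof -
  define I where "I = error_positions \<alpha> n P"
  have I: "I \<subseteq> {..<n}" "finite I" unfolding I_def error_positions_def by auto
  define A where "A = insert 0 (locator_roots \<alpha> n P)"
  have 0: "0 \<notin> locator_roots \<alpha> n P" using nonzero by (auto simp: locator_roots_eq)
  have "card A = Suc (card I)"
    using 0 I by (simp add: A_def I_def card_locator_roots)
  moreover have "poly P x = poly (locator \<alpha> I) x" if "x \<in> A" for x
  proof (cases "x = 0")
    case True
    then show ?thesis using assms(1) by (simp add: poly_0_coeff_0)
  next
    case False
    then have "x \<in> locator_roots \<alpha> n P" using that by (simp add: A_def)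
    then obtain i where "i \<in> I" "x = inverse (\<alpha> ^ i)"
      by (auto simp: locator_roots_eq I_def)
    then show ?thesis
      using poly_locator_eq_0_iff[OF I(1)] I(1) by (auto simp: I_def error_positions_def)
  qed
  ultimately show ?thesis
    unfolding I_def[symmetric] using assms(2)
    by (intro poly_eqI_degree[of A]) (auto simp: degree_locator[OF nonzero] I_def)
qed

lemma poly_evaluator:
  assumes "I \<subseteq> {..<n}" and "i \<in> I"
  shows "poly (evaluator \<alpha> m0 I E) (inverse (\<alpha> ^ i)) =
    coeff E i * (\<alpha> ^ i) powi m0 * poly (locator \<alpha> (I - {i})) (inverse (\<alpha> ^ i))"
proof -
  have "finite I" using assms(1) finite_subset by blast
  have "poly (locator \<alpha> (I - {j})) (inverse (\<alpha> ^ i)) = 0" if "j \<in> I - {i}" for j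
    using assms that poly_locator_eq_0_iff[of "I - {j}" i] by auto
  then show ?thesis
    unfolding evaluator_def poly_sum
    using assms(2) \<open>finite I\<close> by (subst sum.remove[of _ i]) auto
qed

lemma poly_pderiv_locator:
  assumes "I \<subseteq> {..<n}" and "i \<in> I"
  shows "poly (pderiv (locator \<alpha> I)) (inverse (\<alpha> ^ i)) =
    - (\<alpha> ^ i) * poly (locator \<alpha> (I - {i})) (inverse (\<alpha> ^ i))"
proof -
  have "finite I" using assms(1) finite_subset by blast
  then have "pderiv (locator \<alpha> I) = pderiv ([:1, - (\<alpha> ^ i):] * locator \<alpha> (I - {i}))"
    using locator_remove[OF _ assms(2)] by metis
  also have "\<dots> = smult (- (\<alpha> ^ i)) (locator \<alpha> (I - {i})) +
      [:1, - (\<alpha> ^ i):] * pderiv (locator \<alpha> (I - {i}))"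
  proof -
    have "pderiv [:1, - (\<alpha> ^ i):] = [:- (\<alpha> ^ i):]" by (simp add: pderiv_pCons)
    then show ?thesis unfolding pderiv_mult by (simp only: add.commute) simp
  qed
  finally have "pderiv (locator \<alpha> I) = smult (- (\<alpha> ^ i)) (locator \<alpha> (I - {i})) +
      [:1, - (\<alpha> ^ i):] * pderiv (locator \<alpha> (I - {i}))" .
  then show ?thesis using nonzero by simp
qed

lemma locator_remove_nonzero:
  assumes "I \<subseteq> {..<n}" and "i \<in> I"
  shows "poly (locator \<alpha> (I - {i})) (inverse (\<alpha> ^ i)) \<noteq> 0"
  using assms poly_locator_eq_0_iff[of "I - {i}" i] by auto

text \<open>\<open>card I \<le> n - k\<close> makes the reduction modulo \<open>x^(n-k)\<close>
  return the evaluator exactly. At \<open>1/X_i\<close> evaluator and derivative share the factor of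
  the remaining positions; their quotient \<open>- E_i X_i^(m0 - 1)\<close> is turned into
  \<open>E_i\<close> by \<open>- X_i^(1 - m0)\<close>.\<close>

lemma forney_error_locator:
  assumes "I \<subseteq> {..<n}" and "card I \<le> n - k" and "k < n"
    and supp: "\<forall>i. i \<notin> I \<longrightarrow> coeff E i = 0"
    and S: "\<forall>j<n - k. syndrome \<alpha> m0 R j = poly E (\<alpha> powi (int j + m0))"
  shows "forney_error \<alpha> m0 n k R (locator \<alpha> I) = E"
proof -
  let ?S = "syndrome_poly \<alpha> m0 n k R" and ?ev = "evaluator \<alpha> m0 I E"
  have fin: "finite I" using assms(1) finite_subset by blast
  have cS: "coeff ?S j = syndrome \<alpha> m0 R j" if "j < n - k" for j
    using that by (simp add: syndrome_poly_def coeff_sum sum.delta')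
  have "\<forall>j<n - k. fps_nth (fps_of_poly ?S) j = poly E (\<alpha> powi (int j + m0))"
    using S cS by simp
  from key_equation_locator[OF nonzero fin supp this]
  obtain V where V: "key_equation (fps_of_poly ?S) (n - k) (card I) (locator \<alpha> I) ?ev V" ..
  have "coeff (?S * locator \<alpha> I - ?ev) j = 0" if "j < n - k" for j
  proof -
    have "fps_of_poly (?S * locator \<alpha> I - ?ev) = fps_X ^ (n - k) * V"
      using V by (simp add: key_equation_def fps_of_poly_diff fps_of_poly_mult mult.commute)
    then have "coeff (?S * locator \<alpha> I - ?ev) j = fps_nth (fps_X ^ (n - k) * V) j"
      by (metis fps_of_poly_nth)
    then show ?thesis using that by (simp add: fps_X_power_mult_nth)
  qed
  then have "monom 1 (n - k) dvd ?S * locator \<alpha> I - ?ev" by (simp add: monom_1_dvd_iff')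
  then have "(?S * locator \<alpha> I) mod monom 1 (n - k) = ?ev mod monom 1 (n - k)"
    by (simp add: mod_eq_dvd_iff)
  also have "\<dots> = ?ev"
  proof (rule mod_poly_less)
    show "degree ?ev < degree (monom (1 :: 'a) (n - k))"
    proof (cases "?ev = 0")
      case False
      then have "degree ?ev < card I"
        using coeff_evaluator_eq_0[OF nonzero fin] by (metis leading_coeff_0_iff not_le)
      then show ?thesis using assms(2) by (simp add: degree_monom_eq)
    qed (use assms(3) in \<open>simp add: degree_monom_eq\<close>)
  qed
  finally have \<Omega>: "(?S * locator \<alpha> I) mod monom 1 (n - k) = ?ev" .
  have "forney_error \<alpha> m0 n k R (locator \<alpha> I) =
      (\<Sum>i\<in>I. monom (- ((\<alpha> ^ i) powi (1 - m0)) * poly ?ev (inverse (\<alpha> ^ i))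
        / poly (pderiv (locator \<alpha> I)) (inverse (\<alpha> ^ i))) i)"
    unfolding forney_error_def \<Omega> Let_def error_positions_locator[OF assms(1)] eval_point ..
  also have "\<dots> = (\<Sum>i\<in>I. monom (coeff E i) i)"
  proof (rule sum.cong[OF refl])
    fix i assume i: "i \<in> I"
    have pw: "(\<alpha> ^ i) powi (1 - m0) * (\<alpha> ^ i) powi m0 = \<alpha> ^ i"
      using nonzero by (simp flip: power_int_add)
    have swap: "- a * (c * b * l) = c * (- (a * b) * l)" for a b c l :: 'a
      by (simp add: mult_ac)
    have "- ((\<alpha> ^ i) powi (1 - m0)) * poly ?ev (inverse (\<alpha> ^ i)) =
        coeff E i * poly (pderiv (locator \<alpha> I)) (inverse (\<alpha> ^ i))"
      unfolding poly_evaluator[OF assms(1) i] poly_pderiv_locator[OF assms(1) i] swap pw ..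
    moreover have "poly (pderiv (locator \<alpha> I)) (inverse (\<alpha> ^ i)) \<noteq> 0"
      unfolding poly_pderiv_locator[OF assms(1) i]
      using locator_remove_nonzero[OF assms(1) i] nonzero by simp
    ultimately show "monom (- ((\<alpha> ^ i) powi (1 - m0)) * poly ?ev (inverse (\<alpha> ^ i))
        / poly (pderiv (locator \<alpha> I)) (inverse (\<alpha> ^ i))) i = monom (coeff E i) i" by simp
  qed
  also have "\<dots> = E"
    using supp fin by (intro poly_eqI) (auto simp: coeff_sum sum.delta')
  finally show ?thesis .
qed

text \<open>Partial fractions: as \<open>\<Omega>\<close> has no coefficient from
  \<open>card I\<close> on, its quotient by the locator is the syndrome series of an error on
  \<open>I\<close>, and \<open>f\<close> agrees with this series below \<open>x^r\<close>.\<close>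

lemma exists_error_of_key_equation:
  assumes "I \<subseteq> {..<n}"
    and k: "key_equation f r (card I) (locator \<alpha> I) \<Omega> V"
  obtains E where "\<forall>i. i \<notin> I \<longrightarrow> coeff E i = 0"
    and "\<forall>j<r. fps_nth f j = poly E (\<alpha> powi (int j + m0))"
proof -
  have fin: "finite I" using assms(1) finite_subset by blast
  \<comment> \<open>Solves \<open>poly_evaluator\<close> for the error value, with
    \<open>\<Omega>\<close> in the place of the evaluator.\<close>
  define c where "c i = poly \<Omega> (inverse (\<alpha> ^ i)) /
    ((\<alpha> ^ i) powi m0 * poly (locator \<alpha> (I - {i})) (inverse (\<alpha> ^ i)))" for i
  define E where "E = (\<Sum>i\<in>I. monom (c i) i)"
  have E: "coeff E i = (if i \<in> I then c i else 0)" for i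
    using fin by (simp add: E_def coeff_sum sum.delta')
  let ?ev = "evaluator \<alpha> m0 I E"
  have supp: "\<forall>i. i \<notin> I \<longrightarrow> coeff E i = 0" by (simp add: E)
  have "poly (?ev - \<Omega>) (inverse (\<alpha> ^ i)) = 0" if "i \<in> I" for i
    using that nonzero locator_remove_nonzero[OF assms(1) that]
    by (simp add: poly_evaluator[OF assms(1) that] E c_def power_int_eq_0_iff)
  then have sub: "(\<lambda>i. inverse (\<alpha> ^ i)) ` I \<subseteq> {x. poly (?ev - \<Omega>) x = 0}" by auto
  have ev: "?ev = \<Omega>"
  proof (rule ccontr)
    assume "?ev \<noteq> \<Omega>"
    then have nz: "?ev - \<Omega> \<noteq> 0" by simp
    have "card ((\<lambda>i. inverse (\<alpha> ^ i)) ` I) = card I"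
      using assms(1) by (intro card_image inj_on_subset[OF eval_point_inj])
    then have "card I \<le> degree (?ev - \<Omega>)"
      using card_mono[OF poly_roots_finite[OF nz] sub] card_poly_roots_bound[OF nz] by simp
    then have "coeff (?ev - \<Omega>) (degree (?ev - \<Omega>)) = 0"
      using coeff_evaluator_eq_0[OF nonzero fin] k by (simp add: key_equation_def)
    then show False using nz by (metis leading_coeff_0_iff)
  qed
  have "fps_of_poly (locator \<alpha> I) * f = fps_of_poly (locator \<alpha> I) * syndrome_series \<alpha> m0 E + fps_X ^ r * V"
    using k unfolding locator_mult_syndrome_series[OF nonzero fin supp] ev key_equation_def by simp
  then have "fps_of_poly (locator \<alpha> I) * (f - syndrome_series \<alpha> m0 E) = fps_X ^ r * V"
    by (simp add: algebra_simps)
  then have "(inverse (fps_of_poly (locator \<alpha> I)) * fps_of_poly (locator \<alpha> I)) * (f - syndrome_series \<alpha> m0 E)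
      = fps_X ^ r * (inverse (fps_of_poly (locator \<alpha> I)) * V)"
    by (metis mult.assoc mult.left_commute)
  moreover have "inverse (fps_of_poly (locator \<alpha> I)) * fps_of_poly (locator \<alpha> I) = 1"
    by (rule inverse_mult_eq_1) simp
  ultimately have "f - syndrome_series \<alpha> m0 E = fps_X ^ r * (inverse (fps_of_poly (locator \<alpha> I)) * V)"
    by simp
  then have "fps_nth (f - syndrome_series \<alpha> m0 E) j = 0" if "j < r" for j
    using that by (simp add: fps_X_power_mult_nth)
  then have "\<forall>j<r. fps_nth f j = poly E (\<alpha> powi (int j + m0))"
    by (simp add: syndrome_series_def)
  with supp show thesis by (rule that)
qed

lemma RS_code_iff:
  "C \<in> RS_code \<alpha> m0 n k \<longleftrightarrow>
    degree C < n \<and> (\<forall>i<n - k. poly C (\<alpha> powi (int i + m0)) = 0)"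
proof -
  let ?x = "\<lambda>i::nat. \<alpha> powi (m0 + int i)"
  have "inj_on ?x {..<n - k}"
    using inj_on_subset[OF inj, of "{..<n - k}"] nonzero by (auto simp: inj_on_def power_int_add)
  then have "(\<Prod>i<n - k. [:- ?x i, 1:]) = (\<Prod>a\<in>?x ` {..<n - k}. [:- a, 1:] ^ 1)"
    by (simp add: prod.reindex)
  moreover have "(\<Prod>a\<in>?x ` {..<n - k}. [:- a, 1:] ^ 1) dvd C \<longleftrightarrow> (\<forall>i<n - k. poly C (?x i) = 0)"
  proof
    assume d: "(\<Prod>a\<in>?x ` {..<n - k}. [:- a, 1:] ^ 1) dvd C"
    show "\<forall>i<n - k. poly C (?x i) = 0"
    proof (intro allI impI)
      fix i assume "i < n - k"
      then have i: "[:- ?x i, 1:] ^ 1 dvd (\<Prod>a\<in>?x ` {..<n - k}. [:- a, 1:] ^ 1)"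
        by (intro dvd_prodI finite_imageI imageI) simp_all
      show "poly C (?x i) = 0"
        unfolding poly_eq_0_iff_dvd using dvd_trans[OF i d] unfolding power_one_right .
    qed
  next
    assume "\<forall>i<n - k. poly C (?x i) = 0"
    then show "(\<Prod>a\<in>?x ` {..<n - k}. [:- a, 1:] ^ 1) dvd C"
      by (intro prod_linear_power_dvd) (auto simp: poly_eq_0_iff_dvd)
  qed
  ultimately show ?thesis
    by (simp add: RS_code_def words_def add.commute)
qed

end

section \<open>Substitution of a rational function into a bivariate polynomial\<close>

text \<open>The numerator \<open>l^N Q(x, b/l)\<close> of the substitution of the rational function \<open>b/l\<close> for \<open>y\<close>.\<close>

definition hom_eval :: "nat \<Rightarrow> 'a::comm_ring_1 poly \<Rightarrow> 'a \<Rightarrow> 'a \<Rightarrow> 'a" where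
  "hom_eval N Q b l = (\<Sum>v\<le>N. coeff Q v * b ^ v * l ^ (N - v))"

lemma hom_eval_add: "hom_eval N (P + Q) b l = hom_eval N P b l + hom_eval N Q b l"
  by (simp add: hom_eval_def distrib_right sum.distrib)

lemma hom_eval_smult: "hom_eval N (smult c Q) b l = c * hom_eval N Q b l"
  by (simp add: hom_eval_def sum_distrib_left mult.assoc)

lemma hom_eval_pCons:
  "hom_eval (Suc N) (pCons a Q) b l = a * l ^ Suc N + b * hom_eval N Q b l"
  unfolding hom_eval_def sum.atMost_Suc_shift
  by (simp add: sum_distrib_left mult_ac)

lemma hom_eval_Suc:
  assumes "degree Q \<le> N"
  shows "hom_eval (Suc N) Q b l = l * hom_eval N Q b l"
proof -
  have "coeff Q (Suc N) = 0" using assms by (intro coeff_eq_0) simp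
  then have "hom_eval (Suc N) Q b l = (\<Sum>v\<le>N. coeff Q v * b ^ v * l ^ (Suc N - v))"
    by (simp add: hom_eval_def)
  also have "\<dots> = (\<Sum>v\<le>N. l * (coeff Q v * b ^ v * l ^ (N - v)))"
    by (intro sum.cong) (auto simp: Suc_diff_le mult_ac)
  finally show ?thesis by (simp add: hom_eval_def sum_distrib_left)
qed

text \<open>Both sides stand for \<open>l^N Q(c + e b/l)\<close>; the induction avoids dividing by
  \<open>l\<close>. It serves the translation to an interpolation point and the substitution
  \<open>s + x y\<close>.\<close>

lemma hom_eval_pcompose_linear:
  fixes Q :: "'a::idom poly"
  assumes "degree Q \<le> N"
  shows "hom_eval N (Q \<circ>\<^sub>p [:c, e:]) b l = hom_eval N Q (c * l + e * b) l"
  using assms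
proof (induction N arbitrary: Q)
  case 0
  then obtain a where "Q = [:a:]" by (metis degree_eq_zeroE le_zero_eq)
  then show ?case by (simp add: hom_eval_def)
next
  case (Suc N)
  obtain a Q' where Q: "Q = pCons a Q'" by (cases Q)
  have d: "degree Q' \<le> N" using Suc.prems unfolding Q by (simp split: if_splits)
  have d': "degree (Q' \<circ>\<^sub>p [:c, e:]) \<le> N"
    using d degree_pcompose_le[of Q' "[:c, e:]"] mult_left_mono[of "degree [:c, e:]" 1 "degree Q'"]
    by (simp split: if_splits)
  have "Q \<circ>\<^sub>p [:c, e:] = pCons a (smult e (Q' \<circ>\<^sub>p [:c, e:])) + smult c (Q' \<circ>\<^sub>p [:c, e:])"
    by (simp add: Q pcompose_pCons)
  then have "hom_eval (Suc N) (Q \<circ>\<^sub>p [:c, e:]) b l =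
      a * l ^ Suc N + (c * l + e * b) * hom_eval N (Q' \<circ>\<^sub>p [:c, e:]) b l"
    by (simp add: hom_eval_add hom_eval_smult hom_eval_pCons hom_eval_Suc[OF d'] algebra_simps)
  also have "\<dots> = hom_eval (Suc N) Q (c * l + e * b) l"
    by (simp only: Q hom_eval_pCons Suc.IH[OF d])
  finally show ?case .
qed

section \<open>Zeros of the numerator at interpolation points\<close>

lemma pcompose_power: "(p ^ k) \<circ>\<^sub>p q = (p \<circ>\<^sub>p q) ^ k" for p :: "'a::comm_ring_1 poly"
  by (induction k) (simp_all add: pcompose_mult pcompose_1)

lemma linear_power_dvd_of_shift:
  fixes p :: "'a::idom poly"
  assumes "monom 1 k dvd p \<circ>\<^sub>p [:a, 1:]"
  shows "[:- a, 1:] ^ k dvd p"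
proof -
  obtain g where g: "p \<circ>\<^sub>p [:a, 1:] = monom 1 k * g" using assms by (elim dvdE)
  have "p = p \<circ>\<^sub>p ([:a, 1:] \<circ>\<^sub>p [:- a, 1:])" by (simp add: pcompose_pCons)
  also have "\<dots> = (monom 1 k * g) \<circ>\<^sub>p [:- a, 1:]" by (simp only: pcompose_assoc g)
  also have "\<dots> = [:- a, 1:] ^ k * (g \<circ>\<^sub>p [:- a, 1:])"
    by (simp add: pcompose_mult pcompose_power monom_altdef pcompose_pCons)
  finally show ?thesis by (metis dvd_triv_left)
qed

text \<open>After translation to \<open>(a, c)\<close> the coefficient of \<open>y^v\<close> is
  divisible by \<open>(x - a)^(m - v)\<close>, and \<open>b - c l\<close> supplies \<open>v\<close>
  further factors.\<close>

lemma passes_through_finite_dvd: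
  assumes "passes_through_finite m Q a c" and "degree Q \<le> N" and "[:- a, 1:] dvd b - smult c l"
  shows "[:- a, 1:] ^ m dvd hom_eval N Q b l"
proof -
  let ?T = "Q \<circ>\<^sub>p [:[:c:], 1:]"
  have "[:- a, 1:] ^ (m - v) dvd coeff ?T v" for v
  proof (rule linear_power_dvd_of_shift)
    have "coeff (coeff ?T v \<circ>\<^sub>p [:a, 1:]) u = 0" if "u < m - v" for u
      using assms(1) that by (auto simp: passes_through_finite_def shift2_def coeff_map_poly)
    then show "monom 1 (m - v) dvd coeff ?T v \<circ>\<^sub>p [:a, 1:]" by (simp add: monom_1_dvd_iff')
  qed
  then have "[:- a, 1:] ^ m dvd coeff ?T v * (b - smult c l) ^ v * l ^ (N - v)" for v
  proof -
    have "[:- a, 1:] ^ (m - v) * [:- a, 1:] ^ v dvd coeff ?T v * (b - smult c l) ^ v"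
      using \<open>[:- a, 1:] ^ (m - v) dvd coeff ?T v\<close> assms(3) by (intro mult_dvd_mono dvd_power_same)
    moreover have "[:- a, 1:] ^ m dvd [:- a, 1:] ^ (m - v) * [:- a, 1:] ^ v"
      unfolding power_add[symmetric] by (intro le_imp_power_dvd) simp
    ultimately show ?thesis by (meson dvd_mult2 dvd_trans)
  qed
  then have "[:- a, 1:] ^ m dvd hom_eval N ?T (b - smult c l) l"
    unfolding hom_eval_def by (intro dvd_sum)
  also have "hom_eval N ?T (b - smult c l) l = hom_eval N Q b l"
    by (subst hom_eval_pcompose_linear[OF assms(2)]) simp
  finally show ?thesis .
qed

lemma coeff_y_reversal: "coeff (y_reversal N Q) v = (if v \<le> N then coeff Q (N - v) else 0)"
  by (simp add: y_reversal_def coeff_sum sum.delta')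

lemma degree_y_reversal: "degree (y_reversal N Q) \<le> N"
  by (rule degree_le) (simp add: coeff_y_reversal)

text \<open>Replacing \<open>y\<close> by \<open>1/y\<close> swaps numerator and denominator: an
  infinite value is handled as the value 0 of \<open>l/b\<close>.\<close>

lemma hom_eval_y_reversal: "hom_eval N (y_reversal N Q) b l = hom_eval N Q l b"
  unfolding hom_eval_def
  by (rule sum.reindex_bij_witness[of _ "\<lambda>v. N - v" "\<lambda>v. N - v"]) (auto simp: coeff_y_reversal)

section \<open>Rational factorization\<close>

lemma rational_root_at_0:
  fixes Q :: "'a::field poly poly"
  assumes "hom_eval N Q b l = 0" and "degree Q \<le> N" and "poly l 0 \<noteq> 0"
  shows "poly (map_poly (\<lambda>p. poly p 0) Q) (poly b 0 / poly l 0) = 0"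
proof -
  define s where "s = poly b 0 / poly l 0"
  have b: "poly b 0 = s * poly l 0" using assms(3) by (simp add: s_def)
  have "0 = poly (hom_eval N Q b l) 0" by (simp add: assms(1))
  also have "\<dots> = (\<Sum>v\<le>N. poly (coeff Q v) 0 * s ^ v * poly l 0 ^ N)"
    unfolding hom_eval_def poly_sum
  proof (rule sum.cong[OF refl])
    fix v assume "v \<in> {..N}"
    then have "poly l 0 ^ N = poly l 0 ^ v * poly l 0 ^ (N - v)" by (simp flip: power_add)
    then show "poly (coeff Q v * b ^ v * l ^ (N - v)) 0 = poly (coeff Q v) 0 * s ^ v * poly l 0 ^ N"
      by (simp add: b power_mult_distrib)
  qed
  also have "\<dots> = (\<Sum>v\<le>N. poly (coeff Q v) 0 * s ^ v) * poly l 0 ^ N"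
    by (rule sum_distrib_right[symmetric])
  finally have "(\<Sum>v\<le>N. poly (coeff Q v) 0 * s ^ v) = 0" using assms(3) by simp
  moreover have "poly (map_poly (\<lambda>p. poly p 0) Q) s = (\<Sum>v\<le>N. poly (coeff Q v) 0 * s ^ v)"
  proof -
    have "degree (map_poly (\<lambda>p. poly p 0) Q) \<le> N"
      using assms(2) by (intro degree_le) (auto simp: coeff_map_poly coeff_eq_0)
    then have "poly (map_poly (\<lambda>p. poly p 0) Q) s =
        (\<Sum>v\<le>N. coeff (map_poly (\<lambda>p. poly p 0) Q) v * s ^ v)"
      unfolding poly_altdef by (intro sum.mono_neutral_left) (auto simp: coeff_eq_0)
    then show ?thesis by (simp add: coeff_map_poly)
  qed
  ultimately show ?thesis by (simp add: s_def)
qed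

text \<open>The powers of \<open>x\<close> dividing \<open>Q(x, s + x y)\<close> are bounded by the
  degree of its leading coefficient in \<open>y\<close>, so \<open>GREATEST\<close> is a genuine
  maximum. The substituted polynomial has degree 1 in \<open>y\<close>, which preserves the
  \<open>y\<close>-degree.\<close>

lemma rf_step_decomposition:
  assumes "Q \<noteq> 0"
  obtains a where "Q \<circ>\<^sub>p [:[:s:], [:0, 1:]:] = smult (monom 1 a) (rf_step s Q)"
    and "rf_step s Q \<noteq> 0" and "degree (rf_step s Q) \<le> degree Q"
proof -
  define P where "P = Q \<circ>\<^sub>p [:[:s:], [:0, 1:]:]"
  define a where "a = (GREATEST a. [:monom 1 a:] dvd P)"
  have dP: "degree P = degree Q" by (simp add: P_def degree_pcompose)
  have "P \<noteq> 0"
    using assms pcompose_eq_0[of Q "[:[:s:], [:0, 1:]:]"] by (auto simp: P_def)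
  then have lc: "coeff P (degree P) \<noteq> 0" by simp
  have "[:monom 1 a:] dvd P"
    unfolding a_def
  proof (rule GreatestI_nat[where k = 0 and b = "degree (coeff P (degree P))"])
    show "[:monom 1 0:] dvd P" by (simp add: monom_0 flip: one_pCons)
    fix c assume "[:monom 1 c:] dvd P"
    then have "monom 1 c dvd coeff P (degree P)" by (simp add: const_poly_dvd_iff)
    then show "c \<le> degree (coeff P (degree P))"
      using dvd_imp_degree_le[OF _ lc] by (fastforce simp: degree_monom_eq)
  qed
  then have "[:monom 1 a:] * (P div [:monom 1 a:]) = P" by (rule dvd_mult_div_cancel)
  moreover have "rf_step s Q = P div [:monom 1 a:]"
    by (simp add: rf_step_def P_def a_def Let_def)
  ultimately have eq: "P = smult (monom 1 a) (rf_step s Q)" by simp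
  have "degree (rf_step s Q) \<le> degree Q"
    using arg_cong[OF eq, of degree] unfolding dP[symmetric] by simp
  moreover have "rf_step s Q \<noteq> 0" using \<open>P \<noteq> 0\<close> eq by auto
  ultimately show thesis using that eq by (simp add: P_def)
qed

text \<open>With \<open>s = b(0)/l(0)\<close> one has \<open>b - s l = x b'\<close>, that is
  \<open>b/l = s + x (b'/l)\<close>: the denominator stays fixed through the recursion, and
  \<open>b'/l\<close> is a root of \<open>rf_step s Q\<close>.\<close>

lemma rational_factorization_complete:
  assumes "Q \<noteq> 0" and "degree Q \<le> N" and "hom_eval N Q b l = 0" and "poly l 0 \<noteq> 0"
  shows "\<exists>p\<in>rational_factorization L Q. monom 1 L dvd b - p * l"
  using assms(1-3)
proof (induction L arbitrary: Q b)
  case 0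
  then show ?case by (simp add: monom_0 flip: one_pCons)
next
  case (Suc L)
  define s where "s = poly b 0 / poly l 0"
  have "poly (b - smult s l) 0 = 0" using assms(4) by (simp add: s_def)
  then obtain b' where b': "b - smult s l = [:0, 1:] * b'"
    unfolding poly_eq_0_iff_dvd by (auto elim: dvdE)
  then have b: "[:s:] * l + [:0, 1:] * b' = b" by (simp add: algebra_simps)
  from rf_step_decomposition[OF Suc.prems(1)]
  obtain a where a: "Q \<circ>\<^sub>p [:[:s:], [:0, 1:]:] = smult (monom 1 a) (rf_step s Q)"
    and nz: "rf_step s Q \<noteq> 0" and dg: "degree (rf_step s Q) \<le> degree Q" .
  have "monom 1 a * hom_eval N (rf_step s Q) b' l = hom_eval N (Q \<circ>\<^sub>p [:[:s:], [:0, 1:]:]) b' l"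
    by (simp add: a hom_eval_smult)
  also have "\<dots> = 0"
    using hom_eval_pcompose_linear[OF Suc.prems(2), of "[:s:]" "[:0, 1:]" b' l] Suc.prems(3)
    unfolding b by simp
  finally have "hom_eval N (rf_step s Q) b' l = 0" by (simp add: monom_eq_0_iff)
  from Suc.IH[OF nz _ this] dg Suc.prems(2)
  obtain p where p: "p \<in> rational_factorization L (rf_step s Q)" "monom 1 L dvd b' - p * l"
    by auto
  have "b - pCons s p * l = [:0, 1:] * (b' - p * l)"
    using b' by (simp add: algebra_simps)
  moreover have "monom 1 (Suc L) = [:0, 1:] * monom (1 :: 'a) L"
    by (simp add: monom_Suc)
  ultimately have "monom 1 (Suc L) dvd b - pCons s p * l"
    using mult_dvd_mono[OF dvd_refl p(2), of "[:0, 1:]"] by (simp only:)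
  moreover have "pCons s p \<in> rational_factorization (Suc L) Q"
    using rational_root_at_0[OF Suc.prems(3,2) assms(4)] p(1) by (auto simp: s_def)
  ultimately show ?case by blast
qed

section \<open>Existence of interpolation polynomials\<close>

text \<open>Treats finite and infinite points alike: multiplicity becomes the vanishing of additive
  functionals of \<open>Q\<close>, the property behind the counting argument.\<close>

definition taylor_coeff ::
  "nat \<Rightarrow> 'a::{field,finite} \<times> 'a option \<Rightarrow> nat \<Rightarrow> nat \<Rightarrow> 'a poly poly \<Rightarrow> 'a" where
  "taylor_coeff N pt u v Q =
     (case pt of
        (a, Some c) \<Rightarrow> coeff (coeff (shift2 a c Q) v) u
      | (a, None) \<Rightarrow> coeff (coeff (shift2 a 0 (y_reversal N Q)) v) u)"

lemma passes_through_iff_taylor_coeff: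
  "passes_through N m Q pt \<longleftrightarrow> (\<forall>u v. u + v < m \<longrightarrow> taylor_coeff N pt u v Q = 0)"
  by (auto simp: passes_through_def passes_through_finite_def taylor_coeff_def split: prod.splits option.splits)

lemma taylor_coeff_diff:
  "taylor_coeff N pt u v (P - Q) = taylor_coeff N pt u v P - taylor_coeff N pt u v Q"
proof -
  have "shift2 a c (P - Q) = shift2 a c P - shift2 a c Q" for a c and P Q :: "'a poly poly"
    by (rule poly_eqI) (simp add: shift2_def coeff_map_poly pcompose_diff)
  moreover have "y_reversal N (P - Q) = y_reversal N P - y_reversal N Q"
    by (simp add: y_reversal_def sum_subtractf flip: diff_monom)
  ultimately show ?thesis
    by (simp add: taylor_coeff_def split: prod.splits option.splits)
qed

text \<open>
  There are more assignments of values to the admissible coefficients than values of the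
  constraints; the difference of two assignments with equal constraint values is a solution.
\<close>

lemma exists_interpolating_poly:
  fixes pts :: "('a::{field,finite} \<times> 'a option) set"
  assumes "finite M" and card: "card pts * card {(u, v). u + v < m} < card M"
  shows "\<exists>Q. Q \<noteq> 0 \<and> (\<forall>u v. coeff (coeff Q v) u \<noteq> 0 \<longrightarrow> (u, v) \<in> M) \<and>
    (\<forall>pt\<in>pts. passes_through N m Q pt)"
proof -
  define T where "T = {(u, v). u + v < m}"
  have "T \<subseteq> {..m} \<times> {..m}" by (auto simp: T_def)
  then have T: "finite T" by (rule finite_subset) simp
  define F where "F f = (\<Sum>(u, v)\<in>M. monom (monom (f (u, v)) u) v)" for f :: "nat \<times> nat \<Rightarrow> 'a"
  have F: "coeff (coeff (F f) v) u = (if (u, v) \<in> M then f (u, v) else 0)" for f u v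
  proof -
    have "coeff (coeff (F f) v) u = (\<Sum>p\<in>M. if p = (u, v) then f p else 0)"
      unfolding F_def coeff_sum by (intro sum.cong) (auto split: if_splits)
    then show ?thesis using assms(1) by simp
  qed
  define \<Phi> where "\<Phi> f = restrict (\<lambda>(pt, u, v). taylor_coeff N pt u v (F f)) (pts \<times> T)" for f
  let ?A = "M \<rightarrow>\<^sub>E (UNIV :: 'a set)" and ?B = "(pts \<times> T) \<rightarrow>\<^sub>E (UNIV :: 'a set)"
  have two: "1 < CARD('a)"
    using card_mono[of "UNIV :: 'a set" "{0, 1}"] by simp
  have "card ?B < card ?A"
    using card T assms(1) two by (simp add: card_PiE card_cartesian_product T_def)
  moreover have "\<Phi> ` ?A \<subseteq> ?B" by (auto simp: \<Phi>_def split: if_splits)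
  moreover have "finite ?B" using T by (intro finite_PiE) auto
  ultimately have "\<not> inj_on \<Phi> ?A" by (meson card_inj_on_le leD)
  then obtain f g where fg: "f \<in> ?A" "g \<in> ?A" "f \<noteq> g" "\<Phi> f = \<Phi> g"
    by (auto simp: inj_on_def)
  obtain p where p: "f p \<noteq> g p" using fg(3) by (meson ext)
  then have "p \<in> M" using fg(1,2) by (metis PiE_arb)
  then have "coeff (coeff (F f - F g) (snd p)) (fst p) \<noteq> 0" using p by (simp add: F)
  then have "F f - F g \<noteq> 0" by (metis coeff_0)
  moreover have "(u, v) \<in> M" if "coeff (coeff (F f - F g) v) u \<noteq> 0" for u v
    using that by (auto simp: F split: if_splits)
  moreover have "passes_through N m (F f - F g) pt" if "pt \<in> pts" for pt
    unfolding passes_through_iff_taylor_coeff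
  proof (intro allI impI)
    fix u v assume "u + v < m"
    then have "(pt, u, v) \<in> pts \<times> T" using that by (simp add: T_def)
    then have "taylor_coeff N pt u v (F f) = taylor_coeff N pt u v (F g)"
      using fun_cong[OF fg(4), of "(pt, u, v)"] by (simp add: \<Phi>_def)
    then show "taylor_coeff N pt u v (F f - F g) = 0" by (simp add: taylor_coeff_diff)
  qed
  ultimately show ?thesis by blast
qed

section \<open>Numbers of constraints and of monomials\<close>

lemma card_triangle: "2 * card {(u, v). u + v < m} = m * (m + 1)" for m :: nat
proof -
  have "{(u, v). u + v < m} = Sigma {..<m} (\<lambda>u. {..<m - u})" by auto
  then have "card {(u, v). u + v < m} = (\<Sum>u<m. m - u)" by simp
  also have "\<dots> = (\<Sum>u<m. Suc u)"
    by (subst sum.nat_diff_reindex[symmetric]) (intro sum.cong, auto)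
  finally have "card {(u, v). u + v < m} = (\<Sum>u<m. Suc u)" .
  moreover have "2 * (\<Sum>u<m. Suc u) = m * (m + 1)" by (induction m) auto
  ultimately show ?thesis by simp
qed

text \<open>Each \<open>v \<le> N\<close> admits at least \<open>D - w v\<close> exponents
  \<open>u\<close>; a negative difference only lowers the bound, so both signs of \<open>w\<close>
  are covered.\<close>

lemma
  fixes w D :: int and N :: nat
  defines "M \<equiv> {(u, v). v \<le> N \<and> int u + w * int v < D}"
  shows finite_weighted_monomials: "finite M"
    and card_weighted_monomials: "(int N + 1) * (2 * D - w * int N) \<le> 2 * int (card M)"
proof -
  have M: "M = prod.swap ` Sigma {..N} (\<lambda>v. {..<nat (D - w * int v)})"
    by (force simp: M_def)
  then show "finite M" by simp
  have "card M = (\<Sum>v\<le>N. nat (D - w * int v))"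
    unfolding M by (subst card_image) (auto simp: inj_on_def)
  then have "int (card M) = (\<Sum>v\<le>N. int (nat (D - w * int v)))" by simp
  also have "\<dots> \<ge> (\<Sum>v\<le>N. D - w * int v)" by (intro sum_mono) simp
  finally have "2 * (\<Sum>v\<le>N. D - w * int v) \<le> 2 * int (card M)" by simp
  moreover have "2 * (\<Sum>v\<le>N. D - w * int v) = (int N + 1) * (2 * D - w * int N)"
    by (induction N) (auto simp: algebra_simps)
  ultimately show "(int N + 1) * (2 * D - w * int N) \<le> 2 * int (card M)" by simp
qed

section \<open>Weighted degrees and minimal interpolants\<close>

lemma finite_weights: "finite {int u + w * int v | u v. coeff (coeff Q v) u \<noteq> 0}"
proof -
  have "{int u + w * int v | u v. coeff (coeff Q v) u \<noteq> 0} \<subseteq>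
      (\<lambda>(v, u). int u + w * int v) ` Sigma {..degree Q} (\<lambda>v. {..degree (coeff Q v)})"
  proof clarify
    fix u v assume nz: "coeff (coeff Q v) u \<noteq> 0"
    then have "coeff Q v \<noteq> 0" by auto
    then have "(v, u) \<in> Sigma {..degree Q} (\<lambda>v. {..degree (coeff Q v)})"
      using nz by (auto intro: le_degree)
    then show "int u + w * int v \<in>
        (\<lambda>(v, u). int u + w * int v) ` Sigma {..degree Q} (\<lambda>v. {..degree (coeff Q v)})"
      by (rule rev_image_eqI) simp
  qed
  then show ?thesis by (rule finite_subset) simp
qed

lemma weighted_degree_ge:
  "coeff (coeff Q v) u \<noteq> 0 \<Longrightarrow> int u + w * int v \<le> weighted_degree w Q"
  unfolding weighted_degree_def by (rule Max_ge[OF finite_weights]) auto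

lemma weighted_degree_less:
  assumes "Q \<noteq> 0" and "\<And>u v. coeff (coeff Q v) u \<noteq> 0 \<Longrightarrow> int u + w * int v < D"
  shows "weighted_degree w Q < D"
proof -
  have "coeff (coeff Q (degree Q)) (degree (coeff Q (degree Q))) \<noteq> 0" using assms(1) by simp
  then have "{int u + w * int v | u v. coeff (coeff Q v) u \<noteq> 0} \<noteq> {}" by blast
  then show ?thesis
    unfolding weighted_degree_def using assms(2) by (subst Max_less_iff[OF finite_weights]) auto
qed

text \<open>Weighted degrees can be negative when \<open>w\<close> is; the uniform shift allows the
  minimum to be taken over natural numbers.\<close>

lemma weighted_degree_lower_bound:
  assumes "Q \<noteq> 0" and "degree Q \<le> N"
  shows "0 \<le> weighted_degree w Q + \<bar>w\<bar> * int N"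
proof -
  have "coeff (coeff Q (degree Q)) (degree (coeff Q (degree Q))) \<noteq> 0" using assms(1) by simp
  from weighted_degree_ge[OF this, of w] have "w * int (degree Q) \<le> weighted_degree w Q" by linarith
  moreover have "- (\<bar>w\<bar> * int N) \<le> w * int (degree Q)"
  proof -
    have "\<bar>w * int (degree Q)\<bar> \<le> \<bar>w\<bar> * int N"
      unfolding abs_mult using assms(2) by (intro mult_left_mono) auto
    then show ?thesis by linarith
  qed
  ultimately show ?thesis by linarith
qed

lemma exists_is_interpolant:
  assumes "Q \<noteq> 0" and "degree Q \<le> N" and "\<forall>pt\<in>pts. passes_through N m Q pt"
  shows "\<exists>Q. is_interpolant m N w pts Q"
proof -
  define P where "P Q \<longleftrightarrow> Q \<noteq> 0 \<and> degree Q \<le> N \<and> (\<forall>pt\<in>pts. passes_through N m Q pt)" for Q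
  define f where "f Q = nat (weighted_degree w Q + \<bar>w\<bar> * int N)" for Q :: "'a poly poly"
  have "P Q" using assms by (simp add: P_def)
  from ex_has_least_nat[of P, OF this, of f]
  obtain Q' where Q': "P Q'" "\<forall>Q. P Q \<longrightarrow> f Q' \<le> f Q" by blast
  have "weighted_degree w Q' \<le> weighted_degree w Q" if "P Q" for Q
    using Q' that weighted_degree_lower_bound[of Q N w] weighted_degree_lower_bound[of Q' N w]
    by (auto simp: f_def P_def)
  then have "is_arg_min (weighted_degree w) P Q'"
    using Q'(1) by (auto simp: is_arg_min_def not_less)
  then show ?thesis unfolding is_interpolant_def P_def by blast
qed

text \<open>
  The number of monomials exceeds the number of constraints. In \<open>N\<close>, the bound is a quadratic with
  its maximum at \<open>tm/\<tau> - 1/2\<close>; since \<open>N\<close> is the integer nearest to it, the value is at least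
  \<open>tm (tm + \<tau>) / \<tau>\<close>.
\<close>

lemma parameter_inequality:
  fixes t n d m N \<tau> :: int
  assumes \<tau>: "\<tau> = 2 * t - d" "\<tau> > 0" and "t < n" and "t > 0" and "m \<ge> 0"
    and m: "(m + 1) * (t\<^sup>2 - n * \<tau>) > t * (d - t)" and pos: "t\<^sup>2 - n * \<tau> > 0"
    and N: "N * \<tau> \<le> t * m" "t * m < (N + 1) * \<tau>"
  shows "n * (m * (m + 1)) < (N + 1) * (2 * t * m - N * \<tau>)"
proof -
  have 1: "m * (t\<^sup>2 - n * \<tau>) > \<tau> * (n - t)"
    using m by (simp add: \<tau> algebra_simps power2_eq_square)
  then have mpos: "m > 0"
  proof -
    have "m \<noteq> 0"
    proof
      assume "m = 0"
      then have "\<tau> * (n - t) < 0" using 1 by simp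
      moreover have "0 < \<tau> * (n - t)" using \<tau>(2) assms(3) by (intro mult_pos_pos) auto
      ultimately show False by simp
    qed
    then show ?thesis using assms(5) by simp
  qed
  have "t * (t * m + \<tau>) > \<tau> * n * (m + 1)"
    using 1 by (simp add: algebra_simps power2_eq_square)
  then have "m * (t * (t * m + \<tau>)) > m * (\<tau> * n * (m + 1))"
    using mpos by (rule mult_strict_left_mono)
  then have 2: "\<tau> * (n * (m * (m + 1))) < t * m * (t * m + \<tau>)"
    by (simp add: algebra_simps)
  \<comment> \<open>The remainder of \<open>t m\<close> modulo \<open>\<tau>\<close>; the bound
    exceeds \<open>t m (t m + \<tau>) / \<tau>\<close> by exactly
    \<open>\<rho> (\<tau> - \<rho>) / \<tau>\<close>.\<close>
  define \<rho> where "\<rho> = t * m - N * \<tau>"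
  have \<rho>: "0 \<le> \<rho>" "\<rho> < \<tau>" using N by (simp_all add: \<rho>_def algebra_simps)
  then have "0 \<le> \<rho> * (\<tau> - \<rho>)" by simp
  moreover have "\<tau> * ((N + 1) * (2 * t * m - N * \<tau>)) = t * m * (t * m + \<tau>) + \<rho> * (\<tau> - \<rho>)"
    by (simp add: \<rho>_def algebra_simps)
  ultimately have "\<tau> * (n * (m * (m + 1))) < \<tau> * ((N + 1) * (2 * t * m - N * \<tau>))"
    using 2 by linarith
  then show ?thesis using \<tau>(2) by (simp add: mult_less_cancel_left_pos)
qed

text \<open>Squaring \<open>sqrt (n (n - d)) < n - t\<close> gives
  \<open>t^2 - n (2 t - d) > 0\<close>, the positivity of the denominator of \<open>m\<close>. The
  root is at least \<open>n - d\<close>, whence \<open>t < d\<close> and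
  \<open>2 t - d \<le> t\<close>, which makes \<open>N\<close> at least \<open>m\<close>.\<close>

lemma decoding_parameters:
  fixes n d t m N :: nat and t\<^sub>0 :: real
  assumes "d \<le> n" and t0: "t\<^sub>0 = real d / 2" and "t\<^sub>0 < real t"
    and bound: "real t < real n - sqrt (real n * (real n - real d))"
    and m: "m = nat \<lfloor>real t * (2 * t\<^sub>0 - real t) / ((real t)\<^sup>2 - 2 * real n * (real t - t\<^sub>0))\<rfloor>"
    and N: "N = nat \<lfloor>real t * real m / (2 * real t - 2 * t\<^sub>0)\<rfloor>"
  shows "t < d" and "m \<le> N"
    and "int n * (int m * (int m + 1)) < (int N + 1) * (2 * int t * int m - int N * (2 * int t - int d))"
proof -
  define s where "s = sqrt (real n * (real n - real d))"
  have dn: "0 \<le> real n - real d" using assms(1) by simp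
  have s2: "s\<^sup>2 = real n * (real n - real d)" using dn by (simp add: s_def)
  have "(real n - real d)\<^sup>2 \<le> real n * (real n - real d)"
    unfolding power2_eq_square using dn by (intro mult_right_mono) auto
  then have "real n - real d \<le> s" unfolding s_def by (rule real_le_rsqrt)
  then have "real t < real d" using bound by (simp add: s_def)
  then show td: "t < d" by simp
  have s0: "0 \<le> s" using dn by (simp add: s_def)
  have "s < real n - real t" using bound by (simp add: s_def)
  then have "s\<^sup>2 < (real n - real t)\<^sup>2" using s0 by (intro power_strict_mono) auto
  define \<tau> where "\<tau> = 2 * real t - real d"
  have \<tau>: "0 < \<tau>" "\<tau> \<le> real t" using assms(3) td by (auto simp: \<tau>_def t0)
  define \<delta> where "\<delta> = (real t)\<^sup>2 - real n * \<tau>"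
  have \<delta>: "\<delta> > 0"
    using \<open>s\<^sup>2 < (real n - real t)\<^sup>2\<close> unfolding s2
    by (simp add: \<delta>_def \<tau>_def power2_eq_square algebra_simps)
  have "2 * real n * (real t - t\<^sub>0) = real n * \<tau>" by (simp add: \<tau>_def t0 algebra_simps)
  then have m': "m = nat \<lfloor>real t * (real d - real t) / \<delta>\<rfloor>"
    unfolding m \<delta>_def by (simp only: t0) simp
  have "real t * (real d - real t) / \<delta> < real m + 1"
    unfolding m' by linarith
  then have m1: "real t * (real d - real t) < (real m + 1) * \<delta>"
    using \<delta> by (simp add: pos_divide_less_eq)
  have N': "N = nat \<lfloor>real t * real m / \<tau>\<rfloor>" by (simp add: N \<tau>_def t0)
  have y0: "0 \<le> real t * real m / \<tau>" using \<tau> by simp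
  have "real N \<le> real t * real m / \<tau>" "real t * real m / \<tau> < real N + 1"
    using y0 unfolding N' by linarith+
  then have N1: "real N * \<tau> \<le> real t * real m" "real t * real m < (real N + 1) * \<tau>"
    using \<tau> by (simp_all add: pos_le_divide_eq pos_divide_less_eq)
  have "real m * \<tau> \<le> real t * real m"
    unfolding mult.commute[of "real t"] using \<tau>(2) by (intro mult_left_mono) auto
  then have "real m * \<tau> < (real N + 1) * \<tau>" using N1(2) by linarith
  then have "real m < real N + 1" using \<tau>(1) by simp
  then show "m \<le> N" by linarith
  show "int n * (int m * (int m + 1)) < (int N + 1) * (2 * int t * int m - int N * (2 * int t - int d))"
  proof (rule parameter_inequality[OF refl])
    have "real_of_int (2 * int t - int d) > 0" using \<tau>(1) by (simp add: \<tau>_def)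
    then show "2 * int t - int d > 0" by (simp only: of_int_0_less_iff)
    show "int t < int n" using td assms(1) by simp
    show "0 < int t" using assms(3) by (simp add: t0)
    have "real_of_int ((int m + 1) * ((int t)\<^sup>2 - int n * (2 * int t - int d))) >
        real_of_int (int t * (int d - int t))"
      using m1 by (simp add: \<delta>_def \<tau>_def)
    then show "(int m + 1) * ((int t)\<^sup>2 - int n * (2 * int t - int d)) > int t * (int d - int t)"
      by (simp only: of_int_less_iff)
    have "real_of_int ((int t)\<^sup>2 - int n * (2 * int t - int d)) > 0"
      using \<delta> by (simp add: \<delta>_def \<tau>_def)
    then show "(int t)\<^sup>2 - int n * (2 * int t - int d) > 0" by (simp only: of_int_0_less_iff)
    have "real_of_int (int N * (2 * int t - int d)) \<le> real_of_int (int t * int m)"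
      using N1(1) by (simp add: \<tau>_def)
    then show "int N * (2 * int t - int d) \<le> int t * int m" by (simp only: of_int_le_iff)
    have "real_of_int (int t * int m) < real_of_int ((int N + 1) * (2 * int t - int d))"
      using N1(2) by (simp add: \<tau>_def)
    then show "int t * int m < (int N + 1) * (2 * int t - int d)" by (simp only: of_int_less_iff)
  qed simp
qed

text \<open>The numerator of \<open>Q(x, b/lam)\<close> exceeds the weighted degree by at most
  \<open>N (t - Ll)\<close>, so the bound is the one that keeps its degree below \<open>t m\<close>,
  the number of zeros produced by \<open>t\<close> errors.\<close>

lemma exists_low_degree_interpolant:
  fixes pts :: "('a::{field,finite} \<times> 'a option) set"
  assumes "card pts \<le> n" and d: "Ll + Lb = d"
    and ineq: "int n * (int m * (int m + 1)) < (int N + 1) * (2 * int t * int m - int N * (2 * int t - int d))"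
  shows "\<exists>Q. is_interpolant m N (int Ll - int Lb) pts Q"
    and "is_interpolant m N (int Ll - int Lb) pts Q \<Longrightarrow>
      weighted_degree (int Ll - int Lb) Q < int t * int m - int N * (int t - int Ll)"
proof -
  let ?w = "int Ll - int Lb"
  define D where "D = int t * int m - int N * (int t - int Ll)"
  define M where "M = {(u, v). v \<le> N \<and> int u + ?w * int v < D}"
  have "2 * (card pts * card {(u, v). u + v < m}) = card pts * (m * (m + 1))"
    using card_triangle[of m] by (metis mult.left_commute)
  also have "\<dots> \<le> n * (m * (m + 1))" using assms(1) by (rule mult_right_mono) simp
  finally have "2 * int (card pts * card {(u, v). u + v < m}) \<le> int n * (int m * (int m + 1))"
    by (metis (mono_tags) of_nat_1 of_nat_add of_nat_le_iff of_nat_mult of_nat_numeral)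
  also have "\<dots> < (int N + 1) * (2 * int t * int m - int N * (2 * int t - int d))" by (rule ineq)
  \<comment> \<open>\<open>Ll + Lb = d\<close> removes the individual lengths, leaving the
    expression controlled by the parameters.\<close>
  also have "2 * int t * int m - int N * (2 * int t - int d) = 2 * D - ?w * int N"
    by (simp add: D_def algebra_simps flip: d)
  also have "(int N + 1) * (2 * D - ?w * int N) \<le> 2 * int (card M)"
    unfolding M_def by (rule card_weighted_monomials)
  finally have "int (card pts * card {(u, v). u + v < m}) < int (card M)" by linarith
  then have "card pts * card {(u, v). u + v < m} < card M" by (simp only: of_nat_less_iff)
  moreover have "finite M" unfolding M_def by (rule finite_weighted_monomials)
  ultimately obtain Q0 where Q0: "Q0 \<noteq> 0" "\<forall>u v. coeff (coeff Q0 v) u \<noteq> 0 \<longrightarrow> (u, v) \<in> M"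
    "\<forall>pt\<in>pts. passes_through N m Q0 pt"
    using exists_interpolating_poly by blast
  have "coeff Q0 v = 0" if "v > N" for v
    using Q0(2) that by (intro poly_eqI) (force simp: M_def)
  then have deg: "degree Q0 \<le> N" by (intro degree_le) simp
  show "\<exists>Q. is_interpolant m N ?w pts Q"
    by (rule exists_is_interpolant[OF Q0(1) deg Q0(3)])
  assume "is_interpolant m N ?w pts Q"
  then have "\<not> weighted_degree ?w Q0 < weighted_degree ?w Q"
    using Q0 deg by (auto simp: is_interpolant_def is_arg_min_def)
  moreover have "weighted_degree ?w Q0 < D"
    using Q0(2) by (intro weighted_degree_less[OF Q0(1)]) (auto simp: M_def)
  ultimately show "weighted_degree ?w Q < int t * int m - int N * (int t - int Ll)"
    by (simp add: D_def)
qed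

section \<open>Correctness of the list decoder\<close>

text \<open>Trading one factor \<open>l\<close> for one factor \<open>b\<close> changes the degree
  bound by \<open>Ll - Lb\<close>, the weight of \<open>y\<close>, so all terms obey the same
  bound.\<close>

lemma degree_hom_eval:
  fixes Q :: "'a::{field,finite} poly poly"
  assumes nz: "hom_eval N Q b l \<noteq> 0"
    and l: "\<forall>j. j + Ll > e \<longrightarrow> coeff l j = 0" and b: "\<forall>j. j + Lb > e \<longrightarrow> coeff b j = 0"
  shows "int (degree (hom_eval N Q b l)) \<le>
    weighted_degree (int Ll - int Lb) Q + int N * (int e - int Ll)"
proof (rule ccontr)
  let ?w = "int Ll - int Lb" and ?j = "degree (hom_eval N Q b l)"
  assume less: "\<not> ?thesis"
  have dl: "int (degree l) \<le> int e - int Ll" if "l \<noteq> 0"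
    using that l[rule_format, of "degree l"] by (cases "degree l + Ll > e") auto
  have db: "int (degree b) \<le> int e - int Lb" if "b \<noteq> 0"
    using that b[rule_format, of "degree b"] by (cases "degree b + Lb > e") auto
  have "coeff (coeff Q v * b ^ v * l ^ (N - v)) ?j = 0" if v: "v \<le> N" for v
  proof (cases "coeff Q v * b ^ v * l ^ (N - v) = 0")
    case False
    then have nz: "coeff Q v \<noteq> 0" "b ^ v \<noteq> 0" "l ^ (N - v) \<noteq> 0" by auto
    have "int (degree (b ^ v)) \<le> int v * (int e - int Lb)"
    proof (cases "v = 0")
      case False
      then have "b \<noteq> 0" using nz by auto
      then show ?thesis using db by (simp add: degree_power_eq mult_left_mono)
    qed simp
    moreover have "int (degree (l ^ (N - v))) \<le> int (N - v) * (int e - int Ll)"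
    proof (cases "N - v = 0")
      case False
      then have "l \<noteq> 0" using nz by auto
      then show ?thesis using dl by (simp add: degree_power_eq mult_left_mono del: of_nat_diff)
    qed simp
    moreover have "int (degree (coeff Q v)) + ?w * int v \<le> weighted_degree ?w Q"
      using nz(1) by (intro weighted_degree_ge) simp
    ultimately have "int (degree (coeff Q v * b ^ v * l ^ (N - v))) \<le>
        weighted_degree ?w Q - ?w * int v + int v * (int e - int Lb) + int (N - v) * (int e - int Ll)"
      using nz by (simp add: degree_mult_eq del: of_nat_diff)
    also have "\<dots> = weighted_degree ?w Q + int N * (int e - int Ll)"
      using v by (simp add: of_nat_diff algebra_simps)
    finally show ?thesis using less by (intro coeff_eq_0) simp
  next
    case True
    then show ?thesis by (simp only: coeff_0)
  qed
  then have "coeff (hom_eval N Q b l) ?j = 0"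
    unfolding hom_eval_def coeff_sum by (intro sum.neutral) simp
  then show False using nz by simp
qed

context rs_positions
begin

lemma codeword_error:
  assumes "k < n" and R: "R \<in> words n" and C: "C \<in> RS_code \<alpha> m0 n k"
    and dist: "hamming_dist R C \<le> n - k"
  obtains I W Z where "I \<subseteq> {..<n}" and "card I = hamming_dist R C"
    and "key_equation (Abs_fps (syndrome \<alpha> m0 R)) (n - k) (card I) (locator \<alpha> I) W Z"
    and "\<exists>U V. U * locator \<alpha> I + V * W = 1"
    and "R - forney_error \<alpha> m0 n k R (locator \<alpha> I) = C"
proof -
  define E where "E = R - C"
  define I where "I = {i. coeff E i \<noteq> 0}"
  have C': "degree C < n" "\<forall>i<n - k. poly C (\<alpha> powi (int i + m0)) = 0"
    using C by (simp_all add: RS_code_iff)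
  have "degree E < n" unfolding E_def using R C'(1) by (intro degree_diff_less) (auto simp: words_def)
  then have I: "I \<subseteq> {..<n}" unfolding I_def using le_degree by fastforce
  then have fin: "finite I" using finite_subset by blast
  have cI: "card I = hamming_dist R C" by (simp add: I_def E_def hamming_dist_def)
  have supp: "\<forall>i. i \<notin> I \<longrightarrow> coeff E i = 0" by (simp add: I_def)
  have S: "\<forall>j<n - k. syndrome \<alpha> m0 R j = poly E (\<alpha> powi (int j + m0))"
    using C'(2) by (simp add: syndrome_def E_def)
  then have "\<forall>j<n - k. fps_nth (Abs_fps (syndrome \<alpha> m0 R)) j = poly E (\<alpha> powi (int j + m0))"
    by simp
  from key_equation_locator[OF nonzero fin supp this]
  obtain Z where key: "key_equation (Abs_fps (syndrome \<alpha> m0 R)) (n - k) (card I) (locator \<alpha> I)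
    (evaluator \<alpha> m0 I E) Z" ..
  \<comment> \<open>\<open>I\<close> is the exact support of \<open>E\<close>, so at
    \<open>1/X_i\<close> the evaluator is a nonzero multiple of a nonzero error value.\<close>
  have "\<forall>i\<in>I. poly (evaluator \<alpha> m0 I E) (inverse (\<alpha> ^ i)) \<noteq> 0"
    using poly_evaluator[OF I] locator_remove_nonzero[OF I] nonzero
    by (auto simp: I_def power_int_eq_0_iff)
  from locator_bezout[OF nonzero fin this]
  have bez: "\<exists>U V. U * locator \<alpha> I + V * evaluator \<alpha> m0 I E = 1" .
  have "forney_error \<alpha> m0 n k R (locator \<alpha> I) = E"
    using forney_error_locator[OF I _ assms(1) supp S] dist cI by simp
  then have "R - forney_error \<alpha> m0 n k R (locator \<alpha> I) = C" by (simp add: E_def)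
  with I cI key bez show thesis by (rule that)
qed

text \<open>Serves the branch \<open>LxB > t\<close>, whose word is returned without a membership
  test.\<close>

lemma locator_gives_codeword:
  assumes "k < n" and R: "R \<in> words n" and I: "I \<subseteq> {..<n}" "card I \<le> n - k"
    and key: "key_equation (Abs_fps (syndrome \<alpha> m0 R)) (n - k) (card I) (locator \<alpha> I) W Z"
  shows "R - forney_error \<alpha> m0 n k R (locator \<alpha> I) \<in> RS_code \<alpha> m0 n k"
    and "hamming_dist R (R - forney_error \<alpha> m0 n k R (locator \<alpha> I)) \<le> card I"
proof -
  from exists_error_of_key_equation[OF I(1) key, of m0]
  obtain E where supp: "\<forall>i. i \<notin> I \<longrightarrow> coeff E i = 0"
    and S: "\<forall>j<n - k. fps_nth (Abs_fps (syndrome \<alpha> m0 R)) j = poly E (\<alpha> powi (int j + m0))" .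
  have S': "\<forall>j<n - k. syndrome \<alpha> m0 R j = poly E (\<alpha> powi (int j + m0))" using S by simp
  have eq: "forney_error \<alpha> m0 n k R (locator \<alpha> I) = E"
    by (rule forney_error_locator[OF I assms(1) supp S'])
  have "degree E \<le> n - 1" using supp I(1) by (intro degree_le) auto
  then have "degree (R - E) < n"
    using R assms(1) by (intro degree_diff_less) (auto simp: words_def)
  then show "R - forney_error \<alpha> m0 n k R (locator \<alpha> I) \<in> RS_code \<alpha> m0 n k"
    using S' by (simp add: eq RS_code_iff syndrome_def)
  have "{i. coeff R i \<noteq> coeff (R - E) i} \<subseteq> I" using supp by auto
  then show "hamming_dist R (R - forney_error \<alpha> m0 n k R (locator \<alpha> I)) \<le> card I"
    unfolding eq hamming_dist_def using I(1) by (intro card_mono) (auto intro: finite_subset)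
qed

text \<open>With \<open>e = card I\<close> there are at least \<open>m e\<close> zeros, counted with
  multiplicity, while the degree is below \<open>t m - N (t - e)\<close>. Each error short of
  \<open>t\<close> costs \<open>m\<close> zeros but lowers the bound by
  \<open>N \<ge> m\<close>.\<close>

lemma interpolant_root:
  fixes \<Lambda> B lam b :: "'a poly"
  assumes I: "I \<subseteq> {..<n}" "card I \<le> t" and "m \<le> N"
    and roots: "lam * \<Lambda> + b * ([:0, 1:] * B) = locator \<alpha> I"
    and bezout: "U * \<Lambda> + V * ([:0, 1:] * B) = monom 1 r"
    and lam: "\<forall>j. j + Ll > card I \<longrightarrow> coeff lam j = 0"
    and b: "\<forall>j. j + Lb > card I \<longrightarrow> coeff b j = 0"
    and Q: "is_interpolant m N (int Ll - int Lb) (interpolation_point \<alpha> \<Lambda> B ` {..<n}) Q"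
    and wdeg: "weighted_degree (int Ll - int Lb) Q < int t * int m - int N * (int t - int Ll)"
  shows "hom_eval N Q b lam = 0"
proof (rule ccontr)
  assume nz: "hom_eval N Q b lam \<noteq> 0"
  have Q': "Q \<noteq> 0" "degree Q \<le> N"
    "\<forall>i<n. passes_through N m Q (interpolation_point \<alpha> \<Lambda> B i)"
    using Q by (auto simp: is_interpolant_def is_arg_min_def)
  have "[:- inverse (\<alpha> ^ i), 1:] ^ m dvd hom_eval N Q b lam" if i: "i \<in> I" for i
  proof -
    define a where "a = inverse (\<alpha> ^ i)"
    have a: "a \<noteq> 0" using nonzero by (simp add: a_def)
    have "i < n" using i I(1) by auto
    have root: "poly lam a * poly \<Lambda> a + poly b a * (a * poly B a) = 0"
      using poly_locator_eq_0_iff[OF I(1) \<open>i < n\<close>] i arg_cong[OF roots, of "\<lambda>p. poly p a"]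
      by (simp add: a_def mult.left_commute)
    have pass: "passes_through N m Q (interpolation_point \<alpha> \<Lambda> B i)"
      using Q'(3) \<open>i < n\<close> by blast
    show ?thesis
    proof (cases "poly B a = 0")
      case True
      \<comment> \<open>At an infinite point the Bezout identity excludes a zero of
        \<open>\<Lambda>\<close>, so the root condition forces \<open>lam\<close> to vanish.\<close>
      have "poly U a * poly \<Lambda> a = a ^ r"
        using arg_cong[OF bezout, of "\<lambda>p. poly p a"] True by (simp add: poly_monom)
      then have "poly \<Lambda> a \<noteq> 0" using a by auto
      then have "poly (lam - smult 0 b) a = 0" using root True by simp
      moreover have "passes_through_finite m (y_reversal N Q) a 0"
        using pass True by (simp add: passes_through_def interpolation_point_def Let_def a_def)
      ultimately have "[:- a, 1:] ^ m dvd hom_eval N (y_reversal N Q) lam b"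
        unfolding poly_eq_0_iff_dvd
        by (intro passes_through_finite_dvd[OF _ degree_y_reversal])
      then show ?thesis by (simp add: hom_eval_y_reversal a_def)
    next
      case False
      define c where "c = - poly \<Lambda> a / (a * poly B a)"
      have "poly (b - smult c lam) a = 0"
        using root a False by (simp add: c_def field_simps)
      moreover have "passes_through_finite m Q a c"
        using pass False by (simp add: passes_through_def interpolation_point_def Let_def a_def c_def)
      ultimately have "[:- a, 1:] ^ m dvd hom_eval N Q b lam"
        unfolding poly_eq_0_iff_dvd by (intro passes_through_finite_dvd[OF _ Q'(2)])
      then show ?thesis by (simp add: a_def)
    qed
  qed
  then have "m * card ((\<lambda>i. inverse (\<alpha> ^ i)) ` I) \<le> degree (hom_eval N Q b lam)"
    using I(1) nz by (intro prod_linear_power_degree) (auto intro: finite_subset)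
  moreover have "card ((\<lambda>i. inverse (\<alpha> ^ i)) ` I) = card I"
    using I(1) by (intro card_image inj_on_subset[OF eval_point_inj])
  ultimately have "int m * int (card I) \<le> int (degree (hom_eval N Q b lam))"
    by (simp flip: of_nat_mult)
  also have "\<dots> \<le> weighted_degree (int Ll - int Lb) Q + int N * (int (card I) - int Ll)"
    by (rule degree_hom_eval[OF nz lam b])
  finally have "int N * (int t - int (card I)) < int m * (int t - int (card I))"
    using wdeg by (simp add: algebra_simps)
  moreover have "int m * (int t - int (card I)) \<le> int N * (int t - int (card I))"
    using \<open>m \<le> N\<close> I(2) by (intro mult_right_mono) auto
  ultimately show False by simp
qed

end

theorem theorem2:
  fixes \<alpha> :: "'a::{field,finite}"
    and m0 :: int and n k d t m Py :: nat and t\<^sub>0 :: real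
  assumes "primitive_element \<alpha>"
    and "1 \<le> k" and "k < n" and "n \<le> CARD('a) - 1"
    and "d = n - k + 1" and "t\<^sub>0 = real d / 2"
    and "t\<^sub>0 < real t"
    and "real t < real n - sqrt (real n * (real n - real d))"
    and "m = nat \<lfloor>real t * (2 * t\<^sub>0 - real t)
                   / ((real t)\<^sup>2 - 2 * real n * (real t - t\<^sub>0))\<rfloor>"
    and "Py = nat \<lfloor>real t * real m / (2 * real t - 2 * t\<^sub>0)\<rfloor>"
  shows "\<forall>R \<in> words n.
           (\<exists>out. list_decoding \<alpha> m0 n k t m Py R out) \<and>
           (\<forall>out. list_decoding \<alpha> m0 n k t m Py R out \<longrightarrow>
                  out = {C \<in> RS_code \<alpha> m0 n k. hamming_dist R C \<le> t})"
proof
  fix R :: "'a poly"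
  assume R: "R \<in> words n"
  interpret rs_positions \<alpha> n
    using primitive_element_nonzero[OF assms(1)] primitive_element_inj[OF assms(1)] assms(4)
    by unfold_locales (auto intro: inj_on_subset)
  let ?f = "Abs_fps (syndrome \<alpha> m0 R)"
  let ?out = "{C \<in> RS_code \<alpha> m0 n k. hamming_dist R C \<le> t}"
  define st where "st = berlekamp_massey (syndrome \<alpha> m0 R) (n - k)"
  define \<Lambda> B LL LB where \<Lambda>: "\<Lambda> = bm_Lambda st" and B: "B = bm_B st"
    and LL: "LL = bm_L_Lambda st" and LB: "LB = bm_L_B st"
  have inv: "bm_invariant ?f (n - k) st" unfolding st_def by (rule bm_invariant_berlekamp_massey)
  then have L: "LL + LB = n - k" and \<Lambda>0: "coeff \<Lambda> 0 = 1" by (simp_all add: bm_invariant_def \<Lambda> LL LB)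
  have "d \<le> n" using assms(2,3,5) by simp
  note params = decoding_parameters[OF this assms(6-10)]
  have t: "t \<le> n - k" using params(1) assms(5) by simp
  \<comment> \<open>Shared by all branches: \<open>t \<le> n - k\<close> permits Forney's formula,
    and \<open>LL \<le> card I \<le> t\<close> is contradictory when \<open>LL > t\<close>.\<close>
  have codeword: thesis
    if "C \<in> ?out" "\<And>I W Z. I \<subseteq> {..<n} \<Longrightarrow> card I = hamming_dist R C \<Longrightarrow> card I \<le> t \<Longrightarrow> LL \<le> card I \<Longrightarrow>
        key_equation ?f (n - k) (card I) (locator \<alpha> I) W Z \<Longrightarrow>
        \<exists>U V. U * locator \<alpha> I + V * W = 1 \<Longrightarrow>
        R - forney_error \<alpha> m0 n k R (locator \<alpha> I) = C \<Longrightarrow> thesis" for C thesis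
  proof -
    have C: "C \<in> RS_code \<alpha> m0 n k" "hamming_dist R C \<le> n - k" using that(1) t by auto
    from codeword_error[OF assms(3) R C] obtain I W Z where
      "I \<subseteq> {..<n}" "card I = hamming_dist R C"
      and key: "key_equation ?f (n - k) (card I) (locator \<alpha> I) W Z"
      and "\<exists>U V. U * locator \<alpha> I + V * W = 1"
      and "R - forney_error \<alpha> m0 n k R (locator \<alpha> I) = C" .
    moreover have "LL \<le> card I" unfolding LL by (rule bm_L_Lambda_le[OF inv key]) simp
    ultimately show thesis using that by auto
  qed
  consider "LL > t" | "LL \<le> t" "LB + 1 > t" | "LL \<le> t" "LB + 1 \<le> t" by linarith
  then show "(\<exists>out. list_decoding \<alpha> m0 n k t m Py R out) \<and>
    (\<forall>out. list_decoding \<alpha> m0 n k t m Py R out \<longrightarrow> out = ?out)"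
  proof cases
    case 1
    have "list_decoding \<alpha> m0 n k t m Py R out \<longleftrightarrow> out = {}" for out
      using 1 by (simp add: list_decoding_def Let_def flip: st_def LL)
    moreover have "C \<notin> ?out" for C
    proof
      assume "C \<in> ?out"
      then show False by (rule codeword) (use 1 in simp)
    qed
    ultimately show ?thesis by blast
  next
    case 2
    have "list_decoding \<alpha> m0 n k t m Py R out \<longleftrightarrow>
        out = (if card (locator_roots \<alpha> n \<Lambda>) = LL then {R - forney_error \<alpha> m0 n k R \<Lambda>} else {})" for out
      using 2 by (simp add: list_decoding_def Let_def flip: st_def LL LB \<Lambda>)
    moreover have "?out = (if card (locator_roots \<alpha> n \<Lambda>) = LL then {R - forney_error \<alpha> m0 n k R \<Lambda>} else {})"
    proof -
      have deg: "degree \<Lambda> \<le> LL"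
        using inv by (auto simp: bm_invariant_def key_equation_def \<Lambda> LL)
      have only: "card (locator_roots \<alpha> n \<Lambda>) = LL \<and> C = R - forney_error \<alpha> m0 n k R \<Lambda>"
        if "C \<in> ?out" for C
        using that
      proof (rule codeword)
        fix I W Z
        assume I: "I \<subseteq> {..<n}" "card I \<le> t" "LL \<le> card I"
          and key: "key_equation ?f (n - k) (card I) (locator \<alpha> I) W Z"
          and bez: "\<exists>U V. U * locator \<alpha> I + V * W = 1"
          and C: "R - forney_error \<alpha> m0 n k R (locator \<alpha> I) = C"
        have "bm_Lambda st = locator \<alpha> I"
        proof (rule bm_solution_unique[OF inv key])
          \<comment> \<open>\<open>card I \<le> t < LB + 1\<close> leaves no room for a multiple of
            \<open>xB\<close>, so \<open>\<Lambda>\<close> is itself the locator.\<close>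
          show "card I \<le> bm_L_B st" using 2 I(2) by (simp add: LB)
          fix D assume D: "D dvd locator \<alpha> I" "D dvd W"
          obtain U V where UV: "U * locator \<alpha> I + V * W = 1" using bez by blast
          have "D dvd U * locator \<alpha> I + V * W" using D by simp
          then show "is_unit D" unfolding UV .
        qed simp
        then have eq: "\<Lambda> = locator \<alpha> I" by (simp add: \<Lambda>)
        have "LL = card I" using deg I(3) by (simp add: eq degree_locator[OF nonzero])
        then show ?thesis
          using C by (simp add: eq card_locator_roots error_positions_locator[OF I(1)])
      qed
      show ?thesis
      proof (cases "card (locator_roots \<alpha> n \<Lambda>) = LL")
        case True
        define I where "I = error_positions \<alpha> n \<Lambda>"
        have cI: "card I = LL" using True by (simp add: I_def card_locator_roots)
        \<comment> \<open>With \<open>LL\<close> roots and degree at most \<open>LL\<close>,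
          \<open>\<Lambda>\<close> is a locator, and its own key equation makes the returned word a
          codeword.\<close>
        have eq: "\<Lambda> = locator \<alpha> I"
          unfolding I_def using deg cI by (intro locator_error_positions[OF \<Lambda>0]) (simp add: I_def)
        have I: "I \<subseteq> {..<n}" "card I \<le> n - k" using 2 t cI by (auto simp: I_def error_positions_def)
        obtain W Z where "key_equation ?f (n - k) (card I) (locator \<alpha> I) W Z"
          using inv unfolding bm_invariant_def cI LL \<Lambda>[symmetric] eq by blast
        note cw = locator_gives_codeword[OF assms(3) R I this]
        have "hamming_dist R (R - forney_error \<alpha> m0 n k R (locator \<alpha> I)) \<le> t"
          using cw(2) 2(1) unfolding cI by (rule order.trans)
        with cw(1) have mem: "R - forney_error \<alpha> m0 n k R \<Lambda> \<in> ?out"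
          unfolding eq by blast
        have "?out = {R - forney_error \<alpha> m0 n k R \<Lambda>}"
        proof (rule equalityI)
          show "?out \<subseteq> {R - forney_error \<alpha> m0 n k R \<Lambda>}"
            by (rule subsetI, drule only) (simp only: singleton_iff)
          show "{R - forney_error \<alpha> m0 n k R \<Lambda>} \<subseteq> ?out" using mem by (simp only: insert_subset empty_subsetI simp_thms)
        qed
        then show ?thesis unfolding if_P[OF True] .
      next
        case False
        then have "?out = {}" using only by (metis (no_types, lifting) equals0I)
        then show ?thesis unfolding if_not_P[OF False] .
      qed
    qed
    ultimately show ?thesis by simp
  next
    case 3
    let ?pts = "interpolation_point \<alpha> \<Lambda> B ` {..<n}" and ?w = "int LL - int (LB + 1)"
    let ?Ls = "3 * t + 1 - (n - k + 1) - LL"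
    define result where "result Q = {W. \<exists>s \<in> rational_factorization ?Ls Q.
        let \<Lambda>' = candidate_locator t st s
        in card (locator_roots \<alpha> n \<Lambda>') = degree \<Lambda>' \<and>
           W = R - forney_error \<alpha> m0 n k R \<Lambda>' \<and>
           W \<in> RS_code \<alpha> m0 n k \<and> hamming_dist R W \<le> t}" for Q
    have ld: "list_decoding \<alpha> m0 n k t m Py R out \<longleftrightarrow>
        (\<exists>Q. is_interpolant m Py ?w ?pts Q \<and> out = result Q)" for out
      using 3 unfolding list_decoding_def result_def Let_def
      by (simp add: not_less flip: st_def LL LB \<Lambda> B)
    have pts: "card ?pts \<le> n" using card_image_le[of "{..<n}"] by simp
    have "LL + (LB + 1) = d" using L assms(5) by simp
    note interp = exists_low_degree_interpolant[OF pts this params(3)]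
    have "result Q = ?out" if Q: "is_interpolant m Py ?w ?pts Q" for Q
    proof
      show "result Q \<subseteq> ?out" by (auto simp: result_def Let_def)
      show "?out \<subseteq> result Q"
      proof
        fix C assume C: "C \<in> ?out"
        then show "C \<in> result Q"
        proof (rule codeword)
          fix I W Z
          assume I: "I \<subseteq> {..<n}" "card I \<le> t" "LL \<le> card I"
            and key: "key_equation ?f (n - k) (card I) (locator \<alpha> I) W Z"
            and bez: "\<exists>U V. U * locator \<alpha> I + V * W = 1"
            and C': "R - forney_error \<alpha> m0 n k R (locator \<alpha> I) = C"
          from bm_solution_decomposition[OF inv key] obtain lam b \<Omega> \<Theta> where
            P: "locator \<alpha> I = lam * \<Lambda> + b * ([:0, 1:] * B)" and W: "W = lam * \<Omega> + b * \<Theta>"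
            and lam: "\<forall>j. j + LL > card I \<longrightarrow> coeff lam j = 0"
            and b: "\<forall>j. j + (LB + 1) > card I \<longrightarrow> coeff b j = 0"
            and cop: "\<exists>U V. U * \<Lambda> + V * ([:0, 1:] * B) = monom 1 (n - k)"
            unfolding \<Lambda>[symmetric] B[symmetric] LL[symmetric] LB[symmetric] .
          obtain U V where UV: "U * locator \<alpha> I + V * W = 1" using bez by blast
          \<comment> \<open>The decomposition turns the Bezout identity of locator and evaluator
            into one for \<open>lam\<close> and \<open>b\<close>.\<close>
          then have UV': "(U * \<Lambda> + V * \<Omega>) * lam + (U * ([:0, 1:] * B) + V * \<Theta>) * b = 1"
            unfolding P W by (simp only: distrib_left distrib_right mult_ac add_ac)
          obtain U' V' where "U' * \<Lambda> + V' * ([:0, 1:] * B) = monom 1 (n - k)" using cop by blast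
          from interpolant_root[OF I(1,2) params(2) P[symmetric] this lam b Q interp(2)[OF Q]]
          have root: "hom_eval Py Q b lam = 0" .
          have lam0: "coeff lam 0 = 1"
            using arg_cong[OF P, of "\<lambda>p. coeff p 0"] \<Lambda>0 by (simp add: coeff_mult_0)
          have Q': "Q \<noteq> 0" "degree Q \<le> Py"
            using Q by (auto simp: is_interpolant_def is_arg_min_def)
          from rational_factorization_complete[OF Q' root, of ?Ls] lam0
          obtain s where s: "s \<in> rational_factorization ?Ls Q" "monom 1 ?Ls dvd b - s * lam"
            by (auto simp: poly_0_coeff_0)
          have "candidate_locator t st s = lam * bm_Lambda st + b * ([:0, 1:] * bm_B st)"
          proof (rule candidate_locator_eq[OF lam0])
            show "\<forall>j. j + bm_L_Lambda st > t \<longrightarrow> coeff lam j = 0" using lam I(2) by (simp add: LL)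
            show "\<forall>j. j + (bm_L_B st + 1) > t \<longrightarrow> coeff b j = 0" using b I(2) by (simp add: LB)
            show "bm_L_Lambda st \<le> t" "bm_L_B st + 1 \<le> t" using 3 by (simp_all add: LL LB)
            show "(U * \<Lambda> + V * \<Omega>) * lam + (U * ([:0, 1:] * B) + V * \<Theta>) * b = 1" by (rule UV')
            \<comment> \<open>As \<open>LL + LB + 1 = d\<close>, the expansion has exactly the
              \<open>t - LxB + 1\<close> terms that determine \<open>b\<close> from
              \<open>lam\<close> and the \<open>2 (t - LL)\<close> terms that determine
              \<open>lam\<close>.\<close>
            have "t - (LB + 1) + 1 + 2 * (t - LL) = ?Ls" using 3 L by simp
            then show "monom 1 (t - (bm_L_B st + 1) + 1 + 2 * (t - bm_L_Lambda st)) dvd b - s * lam"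
              using s(2) by (simp only: LL LB)
          qed
          then have cand: "candidate_locator t st s = locator \<alpha> I" by (simp only: P \<Lambda> B)
          have "card (locator_roots \<alpha> n (locator \<alpha> I)) = degree (locator \<alpha> I)"
            by (simp add: card_locator_roots error_positions_locator[OF I(1)] degree_locator[OF nonzero])
          then show "C \<in> result Q"
            unfolding result_def Let_def using s(1) cand C C' by (auto intro!: bexI[of _ s])
        qed
      qed
    qed
    then show ?thesis using ld interp(1) by blast
  qed
qed

end
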